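(* Let $\mathcal M=(M,\rho)$ be a finite metric space consisting of $n\ge 3$ points, and let $G$ be a binary tree connecting $M$ (so that $M$ is exactly the set of vertices of $G$ of degree $1$). Then the weight $\mathrm{mpf}_{-}(\mathcal M,G)$ of the generalized minimal parametric filling of type $G$ of $\mathcal M$ is attained at a multi-tour of $G$ whose multiplicity does not exceed $2^{2n-5}$; that is, there exists a multi-tour $\pi$ of $G$ of multiplicity $k\le 2^{2n-5}$ whose multi-perimeter is equal to $\mathrm{mpf}_{-}(\mathcal M,G)$.
   Context: A binary tree is a finite tree all of whose vertices have degree $1$ or $3$; its boundary is the set of all its vertices of degree $1$. A binary tree $G=(V,E)$ connects $M$ if its boundary is $M$. Generalized fillings. For $u,v\in M$ let $\gamma(u,v)$ denote the unique path in $G$ joining $u$ and $v$. A function $\omega\colon E\to\mathbb R$ (negative values allowed) makes $G$ a generalized filling of $\mathcal M$ if $\sum_{e\in\gamma(u,v)}\omega(e)\ge \rho(u,v)$ for all distinct $u,v\in M$. Then $\mathrm{mpf}_{-}(\mathcal M,G)$ is the infimum of $\sum_{e\in E}\omega(e)$ over all such $\omega$. Multi-tours. Each edge $e\in E$ generates a partition $\mathcal P_G(e)=\{M_1,M_2\}$ of $M$, where $M_1,M_2$ are the sets of elements of $M$ lying in the two connected components obtained by deleting $e$ from $G$. A multi-cyclic order of multiplicity $k$ on $M$ ($k$ a positive integer) is a map $\pi\colon\mathbb Z_{nk}\to M$ (where $\mathbb Z_{nk}=\mathbb Z/nk\mathbb Z$) such that $\pi(j)\ne\pi(j+1)$ for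 all $j$ and every element of $M$ has exactly $k$ preimages. It is a multi-tour of $G$ if there is a positive integer $m$ such that for every $e\in E$ and every $M_i\in\mathcal P_G(e)$ there are exactly $m$ elements $p\in\mathbb Z_{nk}$ with $\pi(p)\in M_i$ and $\pi(p+1)\notin M_i$; $m$ is called the multiplicity of the multi-tour, and it is known that then $m=k$. The multi-perimeter of a multi-tour $\pi$ of multiplicity $k$ is $\frac1{2k}\sum_{t\in\mathbb Z_{nk}}\rho(\pi(t),\pi(t+1))$. *)

theory Defs
  imports "HOL-Analysis.Analysis"
begin

text \<open>
  A finite simple graph is given by its vertex set \<open>V\<close> and its set \<open>E\<close> of two-element edges.
\<close>

definition simple_graph :: "'a set \<Rightarrow> 'a set set \<Rightarrow> bool" where
  "simple_graph V E \<longleftrightarrow> finite V \<and> (\<forall>e\<in>E. e \<subseteq> V \<and> card e = 2)"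

definition degree_in :: "'a set set \<Rightarrow> 'a \<Rightarrow> nat" where
  "degree_in E v = card {e \<in> E. v \<in> e}"

definition graph_path :: "'a set \<Rightarrow> 'a set set \<Rightarrow> 'a \<Rightarrow> 'a list \<Rightarrow> 'a \<Rightarrow> bool" where
  "graph_path V E u p v \<longleftrightarrow>
     p \<noteq> [] \<and> hd p = u \<and> last p = v \<and> set p \<subseteq> V \<and> distinct p \<and>
     successively (\<lambda>x y. {x, y} \<in> E) p"

definition graph_cycle :: "'a set \<Rightarrow> 'a set set \<Rightarrow> 'a list \<Rightarrow> bool" where
  "graph_cycle V E c \<longleftrightarrow>
     length c \<ge> 3 \<and> set c \<subseteq> V \<and> distinct c \<and>
     successively (\<lambda>x y. {x, y} \<in> E) c \<and> {last c, hd c} \<in> E"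

definition graph_tree :: "'a set \<Rightarrow> 'a set set \<Rightarrow> bool" where
  "graph_tree V E \<longleftrightarrow>
     simple_graph V E \<and> V \<noteq> {} \<and>
     (\<forall>u\<in>V. \<forall>v\<in>V. \<exists>p. graph_path V E u p v) \<and>
     (\<nexists>c. graph_cycle V E c)"

definition binary_tree :: "'a set \<Rightarrow> 'a set set \<Rightarrow> bool" where
  "binary_tree V E \<longleftrightarrow>
     graph_tree V E \<and> (\<forall>v\<in>V. degree_in E v = 1 \<or> degree_in E v = 3)"

definition tree_boundary :: "'a set \<Rightarrow> 'a set set \<Rightarrow> 'a set" where
  "tree_boundary V E = {v \<in> V. degree_in E v = 1}"

definition connects :: "'a set \<Rightarrow> 'a set set \<Rightarrow> 'a set \<Rightarrow> bool" where
  "connects V E M \<longleftrightarrow> tree_boundary V E = M"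


definition path_edges :: "'a list \<Rightarrow> 'a set set" where
  "path_edges p = {{p ! i, p ! Suc i} | i. Suc i < length p}"

definition tree_path_edges :: "'a set \<Rightarrow> 'a set set \<Rightarrow> 'a \<Rightarrow> 'a \<Rightarrow> 'a set set" where
  "tree_path_edges V E u v = path_edges (THE p. graph_path V E u p v)"

definition generalized_filling ::
  "'a set \<Rightarrow> ('a \<Rightarrow> 'a \<Rightarrow> real) \<Rightarrow> 'a set \<Rightarrow> 'a set set \<Rightarrow> ('a set \<Rightarrow> real) \<Rightarrow> bool" where
  "generalized_filling M \<rho> V E \<omega> \<longleftrightarrow>
     (\<forall>u\<in>M. \<forall>v\<in>M. u \<noteq> v \<longrightarrow> (\<Sum>e\<in>tree_path_edges V E u v. \<omega> e) \<ge> \<rho> u v)"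

text \<open>
  The infimum is taken in the extended reals, where it exists unconditionally;
  on \<^typ>\<open>real\<close>, \<open>Inf\<close> is meaningless for sets that are empty or unbounded below.
\<close>

definition mpf_minus ::
  "'a set \<Rightarrow> ('a \<Rightarrow> 'a \<Rightarrow> real) \<Rightarrow> 'a set \<Rightarrow> 'a set set \<Rightarrow> ereal" where
  "mpf_minus M \<rho> V E = (INF \<omega>\<in>{\<omega>. generalized_filling M \<rho> V E \<omega>}. ereal (\<Sum>e\<in>E. \<omega> e))"


definition graph_components :: "'a set \<Rightarrow> 'a set set \<Rightarrow> 'a set set" where
  "graph_components V E = {{v \<in> V. \<exists>p. graph_path V E u p v} | u. u \<in> V}"

definition edge_partition :: "'a set \<Rightarrow> 'a set set \<Rightarrow> 'a set \<Rightarrow> 'a set \<Rightarrow> 'a set set" where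
  "edge_partition V E M e = {C \<inter> M | C. C \<in> graph_components V (E - {e})}"

text \<open>
  The cyclic group of order \<open>N = card M * k\<close> is represented by \<open>{..<N}\<close>, with
  \<open>Suc j mod N\<close> as the successor of \<open>j\<close>; values of \<open>\<pi>\<close> outside \<open>{..<N}\<close> are irrelevant.
\<close>

definition multi_cyclic_order :: "'a set \<Rightarrow> nat \<Rightarrow> (nat \<Rightarrow> 'a) \<Rightarrow> bool" where
  "multi_cyclic_order M k \<pi> \<longleftrightarrow>
     k > 0 \<and> \<pi> \<in> {..<card M * k} \<rightarrow> M \<and>
     (\<forall>j<card M * k. \<pi> j \<noteq> \<pi> (Suc j mod (card M * k))) \<and>
     (\<forall>x\<in>M. card {j. j < card M * k \<and> \<pi> j = x} = k)"

text \<open>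
  The parameter \<open>k\<close> is the multiplicity of the underlying multi-cyclic order. It
  necessarily equals the crossing number \<open>m\<close>: for the edge \<open>e\<close> at a boundary vertex \<open>x\<close>,
  one class of the partition is \<open>{x}\<close>, and every one of the \<open>k\<close> preimages of \<open>x\<close> is
  followed by a point other than \<open>x\<close>.
\<close>

definition multi_tour ::
  "'a set \<Rightarrow> 'a set set \<Rightarrow> 'a set \<Rightarrow> nat \<Rightarrow> (nat \<Rightarrow> 'a) \<Rightarrow> bool" where
  "multi_tour V E M k \<pi> \<longleftrightarrow>
     multi_cyclic_order M k \<pi> \<and>
     (\<exists>m>0. \<forall>e\<in>E. \<forall>A\<in>edge_partition V E M e.
        card {p. p < card M * k \<and> \<pi> p \<in> A \<and> \<pi> (Suc p mod (card M * k)) \<notin> A} = m)"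

definition multi_perimeter ::
  "'a set \<Rightarrow> ('a \<Rightarrow> 'a \<Rightarrow> real) \<Rightarrow> nat \<Rightarrow> (nat \<Rightarrow> 'a) \<Rightarrow> real" where
  "multi_perimeter M \<rho> k \<pi> =
     1 / (2 * real k) * (\<Sum>t<card M * k. \<rho> (\<pi> t) (\<pi> (Suc t mod (card M * k))))"

end

theory Submission
  imports Defs "Jordan_Normal_Form.Determinant" "Graph_Theory.Euler"
begin

text \<open>
  Minimising the total weight of a generalized filling is a linear program. The unknowns of its
  dual are nonnegative weights \<open>x\<close> on the two-element subsets of \<open>M\<close>, one equation for each edge
  \<open>e\<close>: the pairs separated by \<open>e\<close> have total weight \<open>1\<close>. The objective is \<open>\<Sum>p. x p * \<rho> p\<close>. A
  multi-tour of multiplicity \<open>k\<close> gives a dual solution (half the number of its steps between \<open>u\<close>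
  and \<open>v\<close>, divided by \<open>k\<close>) whose objective value is the multi-perimeter. The proof goes backwards:
  an optimal dual solution with linearly independent columns exists (\<open>lp_basic_optimum\<close>), its
  entries have a common denominator \<open>K \<le> 2 ^ (2 * n - 5)\<close> (\<open>tree_denominator\<close>), and it comes from
  a multi-tour of multiplicity \<open>K\<close> (\<open>multi_tour_of_weights\<close>).

  Both of the last steps rest on one observation. Root the tree at a boundary point \<open>r\<close> and
  let \<open>a\<close> and \<open>b\<close> be the two branches below an inner vertex. The equations of the three edges at
  this vertex force the total weight between \<open>a\<close> and \<open>b\<close> to be \<open>1 / 2\<close>. So the edge equations
  amount to \<open>n - 1\<close> leaf equations (the total weight at a point other than \<open>r\<close> is \<open>1\<close>) and
  \<open>n - 2\<close> node equations (the weight between the branches of an inner vertex is \<open>1 / 2\<close>).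

  Denominators. A pair without \<open>r\<close> occurs in exactly one node equation, that of the
  lowest common ancestor of its points, and a pair with \<open>r\<close> in none. Solving each node equation
  for one of its pairs and substituting leaves a system of leaf equations with integer
  coefficients, with right-hand sides in \<open>\<int> / 2\<close> and with linearly independent columns. A column is a
  difference of two pairs, of \<open>l\<^sub>1\<close>-norm at most \<open>4\<close>, or comes from a pair with \<open>r\<close> and has norm
  \<open>1\<close>. There are at most \<open>n - 1\<close> columns. At least two of them have norm \<open>1\<close>, because
  each of the two branches at the neighbour of \<open>r\<close> exchanges weight \<open>1 / 2\<close> with \<open>r\<close>. A determinant is
  bounded by the product of the norms of its columns, so Cramer's rule gives a denominator
  \<open>K = 2 * d\<close> with \<open>d \<le> 4 ^ (n - 3)\<close>.

  Multi-tours. Draw \<open>K * x {u, v}\<close> arcs from \<open>u\<close> to \<open>v\<close> and as many from \<open>v\<close> to \<open>u\<close>. All in- and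
  out-degrees are \<open>K\<close>. The node equations make the digraph connected, since the two branches
  of every inner vertex are joined by positive weight. A closed Euler walk visits each point \<open>K\<close>
  times and leaves each side of each edge \<open>K\<close> times, so it is a multi-tour.
\<close>

section \<open>Linear programming duality with basic optimal solutions\<close>

text \<open>
  Farkas' lemma for finitely many linear functionals on \<open>E \<rightarrow> \<real>\<close>, by Bartl's induction on their
  number. If the new functional \<open>a m\<close> is needed, some \<open>w0\<close> satisfies the other inequalities but
  violates the conclusion. Projecting all functionals along \<open>w0\<close> onto the kernel of \<open>a m\<close> removes
  \<open>a m\<close>, and the coefficient of \<open>a m\<close> recovered at the end is nonnegative by the choice of \<open>w0\<close>.
\<close>

lemma farkas:
  fixes a :: "'i \<Rightarrow> 'e \<Rightarrow> real" and c :: "'e \<Rightarrow> real"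
  assumes "finite I" and E: "finite E"
    and "\<And>w. (\<forall>i\<in>I. 0 \<le> (\<Sum>e\<in>E. a i e * w e)) \<Longrightarrow> 0 \<le> (\<Sum>e\<in>E. c e * w e)"
  shows "\<exists>x. (\<forall>i\<in>I. 0 \<le> x i) \<and> (\<forall>e\<in>E. c e = (\<Sum>i\<in>I. x i * a i e))"
  using assms(1,3)
proof (induction I arbitrary: a c rule: finite_induct)
  case empty
  have "0 \<le> (\<Sum>e\<in>E. c e * (- c e))" by (rule empty) simp
  then have "(\<Sum>e\<in>E. c e * c e) \<le> 0" by (simp add: sum_negf)
  moreover have "0 \<le> (\<Sum>e\<in>E. c e * c e)" by (simp add: sum_nonneg)
  ultimately have "(\<Sum>e\<in>E. c e * c e) = 0" by simp
  then have "\<forall>e\<in>E. c e = 0" using E by (simp add: sum_nonneg_eq_0_iff)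
  then show ?case by simp
next
  case (insert m I)
  show ?case
  proof (cases "\<forall>w. (\<forall>i\<in>I. 0 \<le> (\<Sum>e\<in>E. a i e * w e)) \<longrightarrow> 0 \<le> (\<Sum>e\<in>E. c e * w e)")
    case True
    then obtain x where x: "\<forall>i\<in>I. 0 \<le> x i" "\<forall>e\<in>E. c e = (\<Sum>i\<in>I. x i * a i e)"
      using insert.IH[of a c] by blast
    have "(\<Sum>i\<in>I. (x(m := 0)) i * a i e) = (\<Sum>i\<in>I. x i * a i e)" for e
      using insert.hyps by (intro sum.cong) auto
    then show ?thesis using x insert.hyps by (intro exI[of _ "x(m := 0)"]) auto
  next
    case False
    then obtain w0 where w0: "\<And>i. i \<in> I \<Longrightarrow> 0 \<le> (\<Sum>e\<in>E. a i e * w0 e)"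
      and cw0: "(\<Sum>e\<in>E. c e * w0 e) < 0" by (auto simp: not_le)
    define D where "D f = (\<Sum>e\<in>E. f e * w0 e)" for f :: "'e \<Rightarrow> real"
    have "D (a m) < 0"
      using insert.prems[of w0] w0 cw0 unfolding D_def by fastforce
    define q where "q = - D (a m)"
    have q: "q > 0" using \<open>D (a m) < 0\<close> q_def by simp
    define pr where "pr f e = f e + D f / q * a m e" for f e
    have D_nonneg: "0 \<le> D (a i)" if "i \<in> I" for i using w0 that D_def by simp
    \<comment> \<open>evaluating at the point shifted along \<open>w0\<close> is evaluating the projected functional\<close>
    have key: "(\<Sum>e\<in>E. f e * (w e + (\<Sum>e\<in>E. a m e * w e) / q * w0 e)) = (\<Sum>e\<in>E. pr f e * w e)" for f w
    proof -
      define r where "r = (\<Sum>e\<in>E. a m e * w e) / q"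
      have "(\<Sum>e\<in>E. f e * (w e + r * w0 e)) = (\<Sum>e\<in>E. f e * w e) + r * D f"
        unfolding D_def by (simp add: distrib_left sum.distrib sum_distrib_left mult.left_commute)
      moreover have "(\<Sum>e\<in>E. pr f e * w e) = (\<Sum>e\<in>E. f e * w e) + D f / q * (\<Sum>e\<in>E. a m e * w e)"
        unfolding pr_def by (simp add: distrib_right sum.distrib sum_distrib_left mult.assoc)
      ultimately show ?thesis by (simp add: r_def)
    qed
    have "\<exists>x. (\<forall>i\<in>I. 0 \<le> x i) \<and> (\<forall>e\<in>E. pr c e = (\<Sum>i\<in>I. x i * pr (a i) e))"
    proof (rule insert.IH)
      fix w assume w: "\<forall>i\<in>I. 0 \<le> (\<Sum>e\<in>E. pr (a i) e * w e)"
      define w' where "w' e = w e + (\<Sum>e\<in>E. a m e * w e) / q * w0 e" for e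
      have "pr (a m) e = 0" for e using q by (simp add: pr_def q_def)
      then have "(\<Sum>e\<in>E. a m e * w' e) = 0" unfolding w'_def key by simp
      moreover have "0 \<le> (\<Sum>e\<in>E. a i e * w' e)" if "i \<in> I" for i
        unfolding w'_def key using w that by blast
      ultimately have "0 \<le> (\<Sum>e\<in>E. c e * w' e)" by (intro insert.prems) auto
      then show "0 \<le> (\<Sum>e\<in>E. pr c e * w e)" unfolding w'_def key .
    qed
    then obtain x where x: "\<forall>i\<in>I. 0 \<le> x i" "\<forall>e\<in>E. pr c e = (\<Sum>i\<in>I. x i * pr (a i) e)" by blast
    define s where "s = ((\<Sum>i\<in>I. x i * D (a i)) - D c) / q"
    have "0 \<le> (\<Sum>i\<in>I. x i * D (a i))" using x(1) D_nonneg by (intro sum_nonneg) auto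
    then have s: "0 \<le> s" using cw0 q unfolding s_def D_def by (intro divide_nonneg_pos) auto
    have "c e = (\<Sum>i\<in>insert m I. (x(m := s)) i * a i e)" if e: "e \<in> E" for e
    proof -
      have "c e = (\<Sum>i\<in>I. x i * pr (a i) e) - D c / q * a m e"
        using x(2) e by (auto simp: pr_def[of c])
      also have "(\<Sum>i\<in>I. x i * pr (a i) e)
          = (\<Sum>i\<in>I. x i * a i e) + (\<Sum>i\<in>I. x i * D (a i)) / q * a m e"
        unfolding pr_def by (simp add: distrib_left sum.distrib sum_distrib_right sum_divide_distrib mult.assoc)
      also have "\<dots> - D c / q * a m e = (\<Sum>i\<in>I. x i * a i e) + s * a m e"
        unfolding s_def by (simp add: algebra_simps diff_divide_distrib)
      also have "(\<Sum>i\<in>I. x i * a i e) = (\<Sum>i\<in>I. (x(m := s)) i * a i e)"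
        using insert.hyps by (intro sum.cong) auto
      finally show ?thesis using insert.hyps by simp
    qed
    then show ?thesis using x(1) s by (intro exI[of _ "x(m := s)"]) auto
  qed
qed

text \<open>
  Feasibility for the problem of maximising \<open>\<Sum>p\<in>P. x p * b p\<close>. Setting \<open>x\<close> to \<open>0\<close> outside \<open>P\<close>
  makes solutions equal as functions when they agree on \<open>P\<close>, so that sets of solutions can be finite.
\<close>

definition lp_feasible :: "'p set \<Rightarrow> 'e set \<Rightarrow> ('p \<Rightarrow> 'e \<Rightarrow> real) \<Rightarrow> ('e \<Rightarrow> real) \<Rightarrow> ('p \<Rightarrow> real) \<Rightarrow> bool" where
  "lp_feasible P E a d x \<longleftrightarrow>
     (\<forall>p. 0 \<le> x p) \<and> (\<forall>p. p \<notin> P \<longrightarrow> x p = 0) \<and> (\<forall>e\<in>E. (\<Sum>p\<in>P. x p * a p e) = d e)"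

definition independent_columns :: "'p set \<Rightarrow> 'e set \<Rightarrow> ('p \<Rightarrow> 'e \<Rightarrow> real) \<Rightarrow> 'p set \<Rightarrow> bool" where
  "independent_columns P E a S \<longleftrightarrow>
     (\<forall>z. (\<forall>p. p \<notin> S \<longrightarrow> z p = 0) \<and> (\<forall>e\<in>E. (\<Sum>p\<in>P. z p * a p e) = 0) \<longrightarrow> (\<forall>p. z p = 0))"

text \<open>
  Strong duality in the form that needs no attained minimum: a number strictly above all values of
  the maximisation problem is also strictly above the value of a solution \<open>w\<close> of the minimisation
  problem.
  Farkas' lemma is applied to the homogenised inequalities \<open>a p \<bullet> w \<ge> b p * \<tau>\<close> and \<open>\<tau> \<ge> 0\<close>, where
  \<open>\<tau>\<close> is the coordinate \<open>None\<close>. The feasible \<open>x0\<close> settles the case \<open>\<tau> = 0\<close>.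
\<close>

lemma lp_approximate_duality:
  fixes a :: "'p \<Rightarrow> 'e \<Rightarrow> real"
  assumes P: "finite P" and E: "finite E"
    and x0: "lp_feasible P E a d x0"
    and upper: "\<And>x. lp_feasible P E a d x \<Longrightarrow> (\<Sum>p\<in>P. x p * b p) \<le> t'"
    and "t' < t"
  shows "\<exists>w. (\<forall>p\<in>P. b p \<le> (\<Sum>e\<in>E. a p e * w e)) \<and> (\<Sum>e\<in>E. d e * w e) < t"
proof (rule ccontr)
  assume "\<not> ?thesis"
  then have no: "\<not> (\<Sum>e\<in>E. d e * w e) < t" if "\<forall>p\<in>P. b p \<le> (\<Sum>e\<in>E. a p e * w e)" for w
    using that by (auto simp del: not_less)
  have opt_sum: "(\<Sum>y\<in>insert None (Some ` A). f y) = f None + (\<Sum>y\<in>A. f (Some y))"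
    if "finite A" for A :: "'z set" and f :: "'z option \<Rightarrow> real"
    using that by (subst sum.insert) (auto simp: sum.reindex)
  define a' where "a' i e = (case i of None \<Rightarrow> (case e of None \<Rightarrow> 1 | Some e \<Rightarrow> 0)
      | Some p \<Rightarrow> (case e of None \<Rightarrow> - b p | Some e \<Rightarrow> a p e))" for i :: "'p option" and e :: "'e option"
  define c' where "c' e = (case e of None \<Rightarrow> - t | Some e \<Rightarrow> d e)" for e :: "'e option"
  have "\<exists>x. (\<forall>i\<in>insert None (Some ` P). 0 \<le> x i) \<and>
      (\<forall>e\<in>insert None (Some ` E). c' e = (\<Sum>i\<in>insert None (Some ` P). x i * a' i e))"
  proof (rule farkas)
    fix w :: "'e option \<Rightarrow> real"
    assume w: "\<forall>i\<in>insert None (Some ` P). 0 \<le> (\<Sum>e\<in>insert None (Some ` E). a' i e * w e)"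
    define \<tau> where "\<tau> = w None"
    define v where "v e = w (Some e)" for e
    have \<tau>: "0 \<le> \<tau>" using w E by (auto simp: opt_sum a'_def \<tau>_def simp del: sum.insert)
    have v: "b p * \<tau> \<le> (\<Sum>e\<in>E. a p e * v e)" if "p \<in> P" for p
      using w E that by (auto simp: opt_sum a'_def \<tau>_def v_def simp del: sum.insert)
    have "t * \<tau> \<le> (\<Sum>e\<in>E. d e * v e)"
    proof (cases "\<tau> = 0")
      case True
      have "(\<Sum>e\<in>E. d e * v e) = (\<Sum>e\<in>E. (\<Sum>p\<in>P. x0 p * a p e) * v e)"
        using x0 by (intro sum.cong) (auto simp: lp_feasible_def)
      also have "\<dots> = (\<Sum>p\<in>P. x0 p * (\<Sum>e\<in>E. a p e * v e))"
        by (simp add: sum_distrib_left sum_distrib_right mult.assoc) (rule sum.swap)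
      also have "\<dots> \<ge> 0" using x0 v True by (auto simp: lp_feasible_def intro!: sum_nonneg[where A = P] mult_nonneg_nonneg)
      finally show ?thesis using True by simp
    next
      case False
      with \<tau> have pos: "\<tau> > 0" by simp
      have "b p \<le> (\<Sum>e\<in>E. a p e * (v e / \<tau>))" if "p \<in> P" for p
        using v[OF that] pos by (simp add: sum_divide_distrib[symmetric] pos_le_divide_eq)
      then have "\<not> (\<Sum>e\<in>E. d e * (v e / \<tau>)) < t" by (intro no[of "\<lambda>e. v e / \<tau>"]) simp
      moreover have "(\<Sum>e\<in>E. d e * (v e / \<tau>)) = (\<Sum>e\<in>E. d e * v e) / \<tau>"
        by (simp add: sum_divide_distrib)
      ultimately show ?thesis using pos by (simp add: pos_le_divide_eq not_less)
    qed
    then show "0 \<le> (\<Sum>e\<in>insert None (Some ` E). c' e * w e)"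
      using E by (simp add: opt_sum c'_def \<tau>_def v_def del: sum.insert)
  qed (use P E in auto)
  then obtain x where x: "\<forall>i\<in>insert None (Some ` P). 0 \<le> x i"
    and eq: "\<forall>e\<in>insert None (Some ` E). c' e = (\<Sum>i\<in>insert None (Some ` P). x i * a' i e)" by blast
  define y where "y p = (if p \<in> P then x (Some p) else 0)" for p
  have y_sum: "(\<Sum>p\<in>P. y p * f p) = (\<Sum>p\<in>P. x (Some p) * f p)" for f
    by (simp add: y_def)
  have "lp_feasible P E a d y"
    using x eq P by (auto simp: lp_feasible_def y_sum opt_sum a'_def c'_def simp del: sum.insert) (auto simp: y_def)
  then have "(\<Sum>p\<in>P. y p * b p) \<le> t'" by (rule upper)
  moreover have "- t = x None - (\<Sum>p\<in>P. y p * b p)"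
    using eq P by (simp add: y_sum opt_sum a'_def c'_def sum_negf del: sum.insert)
  moreover have "0 \<le> x None" using x by simp
  ultimately show False using \<open>t' < t\<close> by simp
qed

text \<open>
  Take a solution of at least the given value with the smallest support. If its columns
  were dependent, one could move along a dependency \<open>z\<close> in the direction that does not
  decrease the objective until some coordinate vanishes. Such a coordinate exists because \<open>lam\<close>
  is positive on all columns, which prevents \<open>z\<close> from being nonnegative.
\<close>

lemma lp_basic_improvement:
  fixes a :: "'p \<Rightarrow> 'e \<Rightarrow> real"
  assumes P: "finite P" and E: "finite E"
    and lam: "\<And>p. p \<in> P \<Longrightarrow> 0 < (\<Sum>e\<in>E. lam e * a p e)"
    and x: "lp_feasible P E a d x"
  shows "\<exists>y. lp_feasible P E a d y \<and> independent_columns P E a {p. y p \<noteq> 0} \<and>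
             (\<Sum>p\<in>P. x p * b p) \<le> (\<Sum>p\<in>P. y p * b p)"
proof -
  define Q where "Q y \<longleftrightarrow> lp_feasible P E a d y \<and> (\<Sum>p\<in>P. x p * b p) \<le> (\<Sum>p\<in>P. y p * b p)" for y
  have "Q x" using x by (simp add: Q_def)
  then obtain y where y: "Q y" and min: "\<And>y'. Q y' \<Longrightarrow> card {p. y p \<noteq> 0} \<le> card {p. y' p \<noteq> 0}"
    using ex_has_least_nat[of Q x "\<lambda>y. card {p. y p \<noteq> 0}"] by blast
  have y0: "\<And>p. 0 \<le> y p" "\<And>p. p \<notin> P \<Longrightarrow> y p = 0" "\<And>e. e \<in> E \<Longrightarrow> (\<Sum>p\<in>P. y p * a p e) = d e"
    using y by (auto simp: Q_def lp_feasible_def)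
  have fin: "finite {p. y p \<noteq> 0}" using y0(2) P by (auto intro: finite_subset)
  have no_dir: False if z: "\<forall>p. y p = 0 \<longrightarrow> z p = 0" "\<forall>e\<in>E. (\<Sum>p\<in>P. z p * a p e) = 0"
    and nz: "z p0 \<noteq> 0" and obj: "0 \<le> (\<Sum>p\<in>P. z p * b p)" for z p0
  proof -
    define h where "h p = (\<Sum>e\<in>E. lam e * a p e)" for p
    have zh: "(\<Sum>p\<in>P. z p * h p) = 0"
    proof -
      have "(\<Sum>p\<in>P. z p * h p) = (\<Sum>p\<in>P. \<Sum>e\<in>E. lam e * (z p * a p e))"
        by (simp add: h_def sum_distrib_left mult_ac)
      also have "\<dots> = (\<Sum>e\<in>E. lam e * (\<Sum>p\<in>P. z p * a p e))"
        by (subst sum.swap) (simp add: sum_distrib_left)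
      finally show ?thesis using z(2) by simp
    qed
    have "\<exists>p\<in>P. z p < 0"
    proof (rule ccontr)
      assume "\<not> ?thesis"
      then have "\<forall>p\<in>P. 0 \<le> z p" by (simp add: not_less)
      then have "\<forall>p\<in>P. z p * h p = 0"
        using zh P lam by (subst sum_nonneg_eq_0_iff[symmetric]) (auto simp: h_def less_imp_le)
      then have "\<forall>p\<in>P. z p = 0" using lam by (force simp: h_def)
      then show False using nz z(1) y0(2) by metis
    qed
    then have N: "finite {p\<in>P. z p < 0}" "{p\<in>P. z p < 0} \<noteq> {}" using P by auto
    \<comment> \<open>the largest step along \<open>z\<close> that keeps all coordinates nonnegative\<close>
    define s where "s = Min ((\<lambda>p. y p / (- z p)) ` {p\<in>P. z p < 0})"
    have "s \<in> (\<lambda>p. y p / (- z p)) ` {p\<in>P. z p < 0}" unfolding s_def using N by (intro Min_in) auto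
    then obtain p1 where p1: "p1 \<in> P" "z p1 < 0" "s = y p1 / (- z p1)" by blast
    have s_le: "s \<le> y p / (- z p)" if "p \<in> P" "z p < 0" for p
      unfolding s_def using N that by (intro Min_le) auto
    have s: "0 \<le> s" using p1 y0(1)[of p1] by (auto simp: divide_nonneg_neg zero_le_divide_iff)
    define y' where "y' p = y p + s * z p" for p
    have y'_sum: "(\<Sum>p\<in>P. y' p * f p) = (\<Sum>p\<in>P. y p * f p) + s * (\<Sum>p\<in>P. z p * f p)" for f
      by (simp add: y'_def algebra_simps sum.distrib sum_distrib_left)
    have "0 \<le> y' p" for p
    proof (cases "p \<in> P \<and> z p < 0")
      case True
      then have "s * (- z p) \<le> y p"
        using s_le[of p] pos_le_divide_eq[of "- z p" s "y p"] by simp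
      then show ?thesis by (simp add: y'_def)
    next
      case False
      then have "0 \<le> z p" using z(1) y0(2)[of p] by (metis not_less order_refl)
      then show ?thesis using y0(1) s by (simp add: y'_def)
    qed
    then have "Q y'"
      using y y0 z s obj by (auto simp: Q_def lp_feasible_def y'_sum) (auto simp: y'_def intro: add_increasing2)
    moreover have "card {p. y' p \<noteq> 0} < card {p. y p \<noteq> 0}"
    proof (rule psubset_card_mono[OF fin])
      have "y' p1 = 0" using p1 by (simp add: y'_def)
      moreover have "y p1 \<noteq> 0" using z(1) p1 by force
      ultimately show "{p. y' p \<noteq> 0} \<subset> {p. y p \<noteq> 0}" using z(1) by (auto simp: y'_def)
    qed
    ultimately show False using min by fastforce
  qed
  have "independent_columns P E a {p. y p \<noteq> 0}"
    unfolding independent_columns_def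
  proof (intro allI impI)
    fix z p assume z: "(\<forall>p. p \<notin> {p. y p \<noteq> 0} \<longrightarrow> z p = 0) \<and> (\<forall>e\<in>E. (\<Sum>p\<in>P. z p * a p e) = 0)"
    show "z p = 0"
    proof (rule ccontr)
      assume nz: "z p \<noteq> 0"
      show False
      proof (cases "0 \<le> (\<Sum>p\<in>P. z p * b p)")
        case True
        then show False using no_dir[of z p] z nz by auto
      next
        case False
        then show False using no_dir[of "\<lambda>p. - z p" p] z nz by (auto simp: sum_negf)
      qed
    qed
  qed
  then show ?thesis using y Q_def by blast
qed

text \<open>
  A solution with independent columns is determined by its support, so there are only finitely many
  of them and the best one is an optimum.
\<close>

lemma lp_basic_optimum:
  fixes a :: "'p \<Rightarrow> 'e \<Rightarrow> real"
  assumes P: "finite P" and E: "finite E"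
    and lam: "\<And>p. p \<in> P \<Longrightarrow> 0 < (\<Sum>e\<in>E. lam e * a p e)"
    and x0: "lp_feasible P E a d x0"
  obtains y where "lp_feasible P E a d y" "independent_columns P E a {p. y p \<noteq> 0}"
    and "\<And>t. (\<Sum>p\<in>P. y p * b p) < t \<Longrightarrow>
           \<exists>w. (\<forall>p\<in>P. b p \<le> (\<Sum>e\<in>E. a p e * w e)) \<and> (\<Sum>e\<in>E. d e * w e) < t"
proof -
  define B where "B = {y. lp_feasible P E a d y \<and> independent_columns P E a {p. y p \<noteq> 0}}"
  have "inj_on (\<lambda>y. {p. y p \<noteq> 0}) B"
  proof (rule inj_onI)
    fix y y' assume yy: "y \<in> B" "y' \<in> B" and eq: "{p. y p \<noteq> 0} = {p. y' p \<noteq> 0}"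
    have "\<forall>p. y p - y' p = 0"
      using yy eq unfolding B_def independent_columns_def
      by (elim CollectE conjE allE[of _ "\<lambda>p. y p - y' p"])
         (auto simp: lp_feasible_def left_diff_distrib sum_subtractf)
    then show "y = y'" by auto
  qed
  moreover have "(\<lambda>y. {p. y p \<noteq> 0}) ` B \<subseteq> Pow P" by (auto simp: B_def lp_feasible_def)
  ultimately have finB: "finite B" using P by (meson finite_Pow_iff inj_on_finite)
  have "B \<noteq> {}" using lp_basic_improvement[OF P E lam x0] by (auto simp: B_def)
  then have "Max ((\<lambda>y. \<Sum>p\<in>P. y p * b p) ` B) \<in> (\<lambda>y. \<Sum>p\<in>P. y p * b p) ` B"
    using finB by (intro Max_in) auto
  then obtain y where y: "y \<in> B" and "(\<Sum>p\<in>P. y p * b p) = Max ((\<lambda>y. \<Sum>p\<in>P. y p * b p) ` B)"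
    by auto
  then have max: "(\<Sum>p\<in>P. y' p * b p) \<le> (\<Sum>p\<in>P. y p * b p)" if "y' \<in> B" for y'
    using finB that by simp
  have "(\<Sum>p\<in>P. x p * b p) \<le> (\<Sum>p\<in>P. y p * b p)" if x: "lp_feasible P E a d x" for x
    using lp_basic_improvement[OF P E lam x, of b] max by (force simp: B_def)
  then show thesis
    using y lp_approximate_duality[OF P E x0, of b "\<Sum>p\<in>P. y p * b p"]
    by (intro that[of y]) (auto simp: B_def)
qed

section \<open>Denominators of solutions of integer linear systems\<close>

text \<open>
  Expanding the product of the column norms gives one summand for every map from columns to
  rows. The determinant uses only the bijective ones.
\<close>

lemma abs_det_le_prod_columns:
  fixes A :: "int mat"
  assumes A: "A \<in> carrier_mat n n"
  shows "\<bar>Determinant.det A\<bar> \<le> (\<Prod>j<n. \<Sum>i<n. \<bar>A $$ (i, j)\<bar>)"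
proof -
  have AT: "transpose_mat A \<in> carrier_mat n n" using A by simp
  have "\<bar>Determinant.det A\<bar> = \<bar>Determinant.det (transpose_mat A)\<bar>" using det_transpose[OF A] by simp
  also have "\<dots> \<le> (\<Sum>p\<in>{p. p permutes {0..<n}}. \<bar>signof p * (\<Prod>i=0..<n. transpose_mat A $$ (i, p i))\<bar>)"
    unfolding det_def'[OF AT] by (rule sum_abs)
  also have "\<dots> = (\<Sum>p\<in>{p. p permutes {0..<n}}. \<Prod>j<n. \<bar>A $$ (p j, j)\<bar>)"
  proof (intro sum.cong refl)
    fix p assume "p \<in> {p. p permutes {0..<n}}"
    then have p: "p permutes {0..<n}" by simp
    have "transpose_mat A $$ (i, p i) = A $$ (p i, i)" if "i < n" for i
      using A that permutes_in_image[OF p, of i] by auto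
    then show "\<bar>signof p * (\<Prod>i=0..<n. transpose_mat A $$ (i, p i))\<bar> = (\<Prod>j<n. \<bar>A $$ (p j, j)\<bar>)"
      by (simp add: abs_mult sign_def abs_prod atLeast0LessThan)
  qed
  also have "\<dots> = (\<Sum>f\<in>(\<lambda>p. restrict p {..<n}) ` {p. p permutes {0..<n}}. \<Prod>j<n. \<bar>A $$ (f j, j)\<bar>)"
  proof (subst sum.reindex)
    show "inj_on (\<lambda>p. restrict p {..<n}) {p. p permutes {0..<n}}"
    proof (rule inj_onI, rule ext)
      fix p q x assume pq: "p \<in> {p. p permutes {0..<n}}" "q \<in> {p. p permutes {0..<n}}"
        and eq: "restrict p {..<n} = restrict q {..<n}"
      show "p x = q x"
      proof (cases "x < n")
        case True then show ?thesis using fun_cong[OF eq, of x] by simp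
      next
        case False then show ?thesis using pq by (auto simp: permutes_def)
      qed
    qed
  qed (auto intro!: sum.cong prod.cong)
  also have "\<dots> \<le> (\<Sum>f\<in>PiE {..<n} (\<lambda>_. {..<n}). \<Prod>j<n. \<bar>A $$ (f j, j)\<bar>)"
  proof (rule sum_mono2)
    show "(\<lambda>p. restrict p {..<n}) ` {p. p permutes {0..<n}} \<subseteq> PiE {..<n} (\<lambda>_. {..<n})"
      by (auto simp: permutes_in_image[where S = "{0..<n}", simplified])
        (metis atLeast0LessThan lessThan_iff permutes_in_image)
  qed (auto intro: finite_PiE prod_nonneg)
  also have "\<dots> = (\<Prod>j<n. \<Sum>i<n. \<bar>A $$ (i, j)\<bar>)"
    by (rule prod_sum_PiE[symmetric]) auto
  finally show ?thesis .
qed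

text \<open>
  A row that completes a nonzero minor exists because otherwise the cofactors of the
  missing last row would be a linear dependency of the columns, nontrivial as its last entry is the
  previous minor.
\<close>

lemma nonzero_minor:
  fixes c :: "nat \<Rightarrow> 'u \<Rightarrow> int"
  assumes "\<And>z :: nat \<Rightarrow> int. (\<forall>u\<in>U. (\<Sum>j<s. c j u * z j) = 0) \<Longrightarrow> (\<forall>j<s. z j = 0)"
  shows "\<exists>r. (\<forall>i<s. r i \<in> U) \<and> Determinant.det (Matrix.mat s s (\<lambda>(i, j). c j (r i))) \<noteq> 0"
  using assms
proof (induction s)
  case 0
  then show ?case by (intro exI[of _ undefined]) simp
next
  case (Suc s)
  have "\<exists>r. (\<forall>i<s. r i \<in> U) \<and> Determinant.det (Matrix.mat s s (\<lambda>(i, j). c j (r i))) \<noteq> 0"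
  proof (rule Suc.IH)
    fix z :: "nat \<Rightarrow> int" assume "\<forall>u\<in>U. (\<Sum>j<s. c j u * z j) = 0"
    then have "\<forall>j<Suc s. (z(s := 0)) j = 0" by (intro Suc.prems) simp
    then show "\<forall>j<s. z j = 0" by (metis fun_upd_other less_SucI nat_neq_iff)
  qed
  then obtain r where r: "\<forall>i<s. r i \<in> U" and nz: "Determinant.det (Matrix.mat s s (\<lambda>(i, j). c j (r i))) \<noteq> 0"
    by blast
  define A where "A u = Matrix.mat (Suc s) (Suc s) (\<lambda>(i, j). c j ((r(s := u)) i))" for u
  define z where "z j = cofactor (A undefined) s j" for j
  have A: "A u \<in> carrier_mat (Suc s) (Suc s)" for u by (simp add: A_def)
  have cof: "cofactor (A u) s j = z j" if "j < Suc s" for u j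
    unfolding z_def cofactor_def A_def mat_delete_def
    by (intro arg_cong2[where f = "(*)"] arg_cong[where f = Determinant.det] refl eq_matI)
      (use that in auto)
  have entry: "A u $$ (s, j) = c j u" if "j < Suc s" for u j using that by (simp add: A_def)
  have det: "Determinant.det (A u) = (\<Sum>j<Suc s. c j u * z j)" for u
    using laplace_expansion_row[OF A, of s u] by (simp add: cof entry del: sum.lessThan_Suc)
  have "z s = Determinant.det (Matrix.mat s s (\<lambda>(i, j). c j (r i)))"
  proof -
    have "mat_delete (A undefined) s s = Matrix.mat s s (\<lambda>(i, j). c j (r i))"
      unfolding mat_delete_def A_def by (intro eq_matI) auto
    then show ?thesis by (simp add: z_def cofactor_def)
  qed
  then have "z s \<noteq> 0" using nz by simp
  then have "\<not> (\<forall>u\<in>U. (\<Sum>j<Suc s. c j u * z j) = 0)" using Suc.prems[of z] by blast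
  then obtain u where "u \<in> U" "Determinant.det (A u) \<noteq> 0" by (auto simp: det)
  then show ?case using r unfolding A_def by (intro exI[of _ "r(s := u)"]) (auto simp: less_Suc_eq)
qed

text \<open>
  The denominator is the absolute value of a nonzero minor of full size. Multiplying the system by
  the adjugate of this minor expresses \<open>k * y\<close> through integers.
\<close>

lemma integer_system_denominator:
  fixes c :: "'p \<Rightarrow> 'u \<Rightarrow> int"
  assumes S: "finite S" and U: "finite U"
    and ind: "\<And>z :: 'p \<Rightarrow> real. (\<forall>u\<in>U. (\<Sum>p\<in>S. z p * of_int (c p u)) = 0) \<Longrightarrow> (\<forall>p\<in>S. z p = 0)"
  shows "card S \<le> card U"
    and "\<exists>k::int. 0 < k \<and> k \<le> (\<Prod>p\<in>S. \<Sum>u\<in>U. \<bar>c p u\<bar>) \<and>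
           (\<forall>y :: 'p \<Rightarrow> real. (\<forall>u\<in>U. (\<Sum>p\<in>S. y p * of_int (c p u)) \<in> \<int>) \<longrightarrow> (\<forall>p\<in>S. of_int k * y p \<in> \<int>))"
proof -
  define s where "s = card S"
  obtain f where f: "bij_betw f {..<s} S"
    using ex_bij_betw_nat_finite[OF S] by (auto simp: s_def atLeast0LessThan)
  have re: "(\<Sum>p\<in>S. g p) = (\<Sum>j<s. g (f j))" for g :: "'p \<Rightarrow> real"
    using sum.reindex_bij_betw[OF f, of g] by simp
  have "\<exists>r. (\<forall>i<s. r i \<in> U) \<and> Determinant.det (Matrix.mat s s (\<lambda>(i, j). c (f j) (r i))) \<noteq> 0"
  proof (rule nonzero_minor)
    fix z :: "nat \<Rightarrow> int" assume z: "\<forall>u\<in>U. (\<Sum>j<s. c (f j) u * z j) = 0"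
    define z' where "z' p = real_of_int (z (inv_into {..<s} f p))" for p
    have z': "z' (f j) = of_int (z j)" if "j < s" for j
      using that f by (simp add: z'_def bij_betw_def inv_into_f_f)
    have "(\<Sum>p\<in>S. z' p * of_int (c p u)) = of_int (\<Sum>j<s. c (f j) u * z j)" for u
      by (simp add: re z' mult.commute)
    then have "\<forall>p\<in>S. z' p = 0" using z by (intro ind) (simp del: of_int_sum)
    then show "\<forall>j<s. z j = 0" using z' f by (metis bij_betwE lessThan_iff of_int_eq_0_iff)
  qed
  then obtain r where r: "\<And>i. i < s \<Longrightarrow> r i \<in> U"
    and nz: "Determinant.det (Matrix.mat s s (\<lambda>(i, j). c (f j) (r i))) \<noteq> 0" by blast
  define A where "A = Matrix.mat s s (\<lambda>(i, j). c (f j) (r i))"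
  have A: "A \<in> carrier_mat s s" by (simp add: A_def)
  have inj: "inj_on r {..<s}"
  proof (rule inj_onI, rule ccontr)
    fix i i' assume ii: "i \<in> {..<s}" "i' \<in> {..<s}" "r i = r i'" "i \<noteq> i'"
    then have "Matrix.row A i = Matrix.row A i'" by (intro eq_vecI) (auto simp: A_def)
    then have "Determinant.det A = 0" using ii det_identical_rows[OF A, of i i'] by auto
    then show False using nz A_def by simp
  qed
  have rU: "r ` {..<s} \<subseteq> U" using r by auto
  show "card S \<le> card U" using card_inj_on_le[OF inj rU U] by (simp add: s_def)
  define k where "k = \<bar>Determinant.det A\<bar>"
  have "k \<le> (\<Prod>j<s. \<Sum>i<s. \<bar>A $$ (i, j)\<bar>)" unfolding k_def by (rule abs_det_le_prod_columns[OF A])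
  also have "\<dots> \<le> (\<Prod>j<s. \<Sum>u\<in>U. \<bar>c (f j) u\<bar>)"
  proof (intro prod_mono conjI)
    fix j assume "j \<in> {..<s}"
    then have "(\<Sum>i<s. \<bar>A $$ (i, j)\<bar>) = (\<Sum>i<s. \<bar>c (f j) (r i)\<bar>)" by (simp add: A_def)
    also have "\<dots> = (\<Sum>u\<in>r ` {..<s}. \<bar>c (f j) u\<bar>)" by (simp add: sum.reindex[OF inj])
    also have "\<dots> \<le> (\<Sum>u\<in>U. \<bar>c (f j) u\<bar>)" by (rule sum_mono2[OF U rU]) simp
    finally show "(\<Sum>i<s. \<bar>A $$ (i, j)\<bar>) \<le> (\<Sum>u\<in>U. \<bar>c (f j) u\<bar>)" .
  qed (auto intro: sum_nonneg)
  also have "\<dots> = (\<Prod>p\<in>S. \<Sum>u\<in>U. \<bar>c p u\<bar>)"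
    using prod.reindex_bij_betw[OF f, of "\<lambda>p. \<Sum>u\<in>U. \<bar>c p u\<bar>"] by simp
  finally have kle: "k \<le> (\<Prod>p\<in>S. \<Sum>u\<in>U. \<bar>c p u\<bar>)" .
  have "of_int k * y p \<in> \<int>" if y: "\<forall>u\<in>U. (\<Sum>p\<in>S. y p * of_int (c p u)) \<in> \<int>" and p: "p \<in> S"
    for y :: "'p \<Rightarrow> real" and p
  proof -
    obtain l where l: "l < s" "f l = p" using p f by (auto simp: bij_betw_def)
    have adj: "(\<Sum>i<s. adj_mat A $$ (l, i) * A $$ (i, j)) = (if l = j then Determinant.det A else 0)"
      if "j < s" for j
    proof -
      have "(adj_mat A * A) $$ (l, j) = (\<Sum>i<s. adj_mat A $$ (l, i) * A $$ (i, j))"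
        using adj_mat(1)[OF A] A l that by (simp add: scalar_prod_def atLeast0LessThan)
      then show ?thesis using adj_mat(3)[OF A] l that by (cases "l = j") auto
    qed
    have "of_int (Determinant.det A) * y p
        = (\<Sum>j<s. of_int (if l = j then Determinant.det A else 0) * y (f j))"
      using l by (subst sum.remove[of _ l]) auto
    also have "\<dots> = (\<Sum>j<s. of_int (\<Sum>i<s. adj_mat A $$ (l, i) * A $$ (i, j)) * y (f j))"
      by (intro sum.cong refl) (simp add: adj)
    also have "\<dots> = (\<Sum>j<s. \<Sum>i<s. of_int (adj_mat A $$ (l, i)) * (y (f j) * of_int (c (f j) (r i))))"
      by (intro sum.cong refl) (auto simp: sum_distrib_right A_def intro!: sum.cong)
    also have "\<dots> = (\<Sum>i<s. of_int (adj_mat A $$ (l, i)) * (\<Sum>p\<in>S. y p * of_int (c p (r i))))"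
      by (subst sum.swap) (simp add: re sum_distrib_left)
    also have "\<dots> \<in> \<int>"
    proof (rule Ints_sum)
      fix i assume "i \<in> {..<s}"
      then show "of_int (adj_mat A $$ (l, i)) * (\<Sum>p\<in>S. y p * of_int (c p (r i))) \<in> \<int>"
        using y r by (intro Ints_mult) auto
    qed
    finally show ?thesis unfolding k_def by (cases "Determinant.det A \<ge> 0") (auto simp: abs_if)
  qed
  then show "\<exists>k::int. 0 < k \<and> k \<le> (\<Prod>p\<in>S. \<Sum>u\<in>U. \<bar>c p u\<bar>) \<and>
           (\<forall>y :: 'p \<Rightarrow> real. (\<forall>u\<in>U. (\<Sum>p\<in>S. y p * of_int (c p u)) \<in> \<int>) \<longrightarrow> (\<forall>p\<in>S. of_int k * y p \<in> \<int>))"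
    using nz kle by (intro exI[of _ k]) (auto simp: k_def A_def)
qed


text \<open>
  Here \<open>p \<in> S\<close> is an unknown that occurs in the equations of the points \<open>u \<in> inc p\<close> and, unless
  \<open>p \<in> Sr\<close>, in the equation of its group \<open>g p\<close>. Each group equation is solved for a representative
  \<open>rep w\<close>, which is substituted in the equations of the points. The remaining columns
  \<open>c p\<close> have \<open>l\<^sub>1\<close>-norm at most \<open>2 + 2\<close>, respectively \<open>1\<close> for \<open>p \<in> Sr\<close>. The factor \<open>2\<close> in
  the bound clears the right-hand sides \<open>1 / 2\<close>.
\<close>

lemma grouped_system_denominator:
  fixes x :: "'p \<Rightarrow> real" and inc :: "'p \<Rightarrow> 'u set" and g :: "'p \<Rightarrow> 'w"
  assumes S: "finite S" and U: "finite U" and "Sr \<subseteq> S" and Sr2: "2 \<le> card Sr"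
    and inc: "\<And>p. p \<in> S \<Longrightarrow> inc p \<subseteq> U"
    and inc1: "\<And>p. p \<in> Sr \<Longrightarrow> card (inc p) = 1"
    and inc2: "\<And>p. p \<in> S - Sr \<Longrightarrow> card (inc p) = 2"
    and ind: "\<And>z :: 'p \<Rightarrow> real. (\<forall>u\<in>U. (\<Sum>p\<in>S. z p * of_bool (u \<in> inc p)) = 0) \<Longrightarrow>
        (\<forall>w\<in>g ` (S - Sr). (\<Sum>p\<in>{p\<in>S - Sr. g p = w}. z p) = 0) \<Longrightarrow> (\<forall>p\<in>S. z p = 0)"
    and x_leaf: "\<And>u. u \<in> U \<Longrightarrow> (\<Sum>p\<in>S. x p * of_bool (u \<in> inc p)) = 1"
    and x_group: "\<And>w. w \<in> g ` (S - Sr) \<Longrightarrow> (\<Sum>p\<in>{p\<in>S - Sr. g p = w}. x p) = 1 / 2"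
  shows "\<exists>K::nat. 0 < K \<and> K \<le> 2 * 4 ^ (card U - 2) \<and> (\<forall>p\<in>S. real K * x p \<in> \<int>)"
proof -
  define W where "W = g ` (S - Sr)"
  define rep where "rep w = (SOME p. p \<in> S - Sr \<and> g p = w)" for w
  have rep: "rep w \<in> S - Sr" "g (rep w) = w" if "w \<in> W" for w
  proof -
    have "\<exists>p. p \<in> S - Sr \<and> g p = w" using that by (auto simp: W_def)
    from someI_ex[OF this] show "rep w \<in> S - Sr" "g (rep w) = w" by (auto simp: rep_def)
  qed
  have gW: "g p \<in> W" if "p \<in> S - Sr" for p using that by (auto simp: W_def)
  have finW: "finite W" using S by (simp add: W_def)
  have inj: "inj_on rep W" using rep(2) by (metis inj_onI)
  define S' where "S' = S - rep ` W"
  have S': "finite S'" using S by (simp add: S'_def)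
  have SrS': "Sr \<subseteq> S'" using \<open>Sr \<subseteq> S\<close> rep(1) by (auto simp: S'_def)
  have repS: "rep ` W \<subseteq> S" using rep(1) by auto
  define c where "c p u = of_bool (u \<in> inc p) - (if p \<in> Sr then 0 else of_bool (u \<in> inc (rep (g p))) :: int)" for p u
  have group: "(\<Sum>p\<in>{p\<in>S - Sr. g p = w}. z p) = z (rep w) + (\<Sum>p\<in>{p\<in>S' - Sr. g p = w}. z p)"
    if "w \<in> W" for w and z :: "'p \<Rightarrow> real"
  proof -
    have eq: "{p\<in>S - Sr. g p = w} - {rep w} = {p\<in>S' - Sr. g p = w}"
      using rep that by (auto simp: S'_def)
    have "(\<Sum>p\<in>{p\<in>S - Sr. g p = w}. z p) = z (rep w) + (\<Sum>p\<in>{p\<in>S - Sr. g p = w} - {rep w}. z p)"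
      using rep[OF that] S by (intro sum.remove) auto
    then show ?thesis unfolding eq .
  qed
  \<comment> \<open>the equation of \<open>u\<close> after substitution, for group equations with right-hand side \<open>s\<close>\<close>
  have reduce: "(\<Sum>p\<in>S. z p * of_bool (u \<in> inc p))
      = (\<Sum>p\<in>S'. z p * of_int (c p u)) + s * (\<Sum>w\<in>W. of_bool (u \<in> inc (rep w)))"
    if z: "\<And>w. w \<in> W \<Longrightarrow> (\<Sum>p\<in>{p\<in>S - Sr. g p = w}. z p) = s" for z :: "'p \<Rightarrow> real" and s u
  proof -
    define i where "i p = (of_bool (u \<in> inc p) :: real)" for p
    have "(\<Sum>p\<in>rep ` W. z p * i p) = (\<Sum>w\<in>W. (s - (\<Sum>p\<in>{p\<in>S' - Sr. g p = w}. z p)) * i (rep w))"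
    proof (subst sum.reindex[OF inj], unfold o_def, rule sum.cong[OF refl])
      fix w assume w: "w \<in> W"
      have "z (rep w) = s - (\<Sum>p\<in>{p\<in>S' - Sr. g p = w}. z p)"
        using group[OF w, of z] z[OF w] by simp
      then show "z (rep w) * i (rep w) = (s - (\<Sum>p\<in>{p\<in>S' - Sr. g p = w}. z p)) * i (rep w)" by simp
    qed
    also have "\<dots> = s * (\<Sum>w\<in>W. i (rep w)) - (\<Sum>w\<in>W. \<Sum>p\<in>{p\<in>S' - Sr. g p = w}. z p * i (rep (g p)))"
      by (simp add: left_diff_distrib sum_subtractf sum_distrib_left sum_distrib_right)
    also have "(\<Sum>w\<in>W. \<Sum>p\<in>{p\<in>S' - Sr. g p = w}. z p * i (rep (g p))) = (\<Sum>p\<in>S' - Sr. z p * i (rep (g p)))"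
      using S' finW gW by (intro sum.group) (auto simp: S'_def)
    finally have reps: "(\<Sum>p\<in>rep ` W. z p * i p) = s * (\<Sum>w\<in>W. i (rep w)) - (\<Sum>p\<in>S' - Sr. z p * i (rep (g p)))" .
    have "(\<Sum>p\<in>S'. z p * of_int (c p u)) = (\<Sum>p\<in>S'. z p * i p) - (\<Sum>p\<in>S'. z p * (if p \<in> Sr then 0 else i (rep (g p))))"
      by (subst sum_subtractf[symmetric]) (auto intro!: sum.cong simp: c_def i_def)
    also have "(\<Sum>p\<in>S'. z p * (if p \<in> Sr then 0 else i (rep (g p)))) = (\<Sum>p\<in>S' - Sr. z p * i (rep (g p)))"
      using S' by (intro sum.mono_neutral_cong_right) auto
    finally have "(\<Sum>p\<in>S'. z p * of_int (c p u)) = (\<Sum>p\<in>S'. z p * i p) - (\<Sum>p\<in>S' - Sr. z p * i (rep (g p)))" .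
    moreover have "(\<Sum>p\<in>S. z p * i p) = (\<Sum>p\<in>S'. z p * i p) + (\<Sum>p\<in>rep ` W. z p * i p)"
      unfolding S'_def using sum.subset_diff[OF repS S] by simp
    ultimately show ?thesis using reps by (simp add: i_def)
  qed
  have ind': "\<forall>p\<in>S'. z p = 0" if z: "\<forall>u\<in>U. (\<Sum>p\<in>S'. z p * of_int (c p u)) = 0" for z :: "'p \<Rightarrow> real"
  proof -
    \<comment> \<open>extend a dependency of the reduced columns so that all group sums vanish\<close>
    define z1 where "z1 p = (if p \<in> S' then z p else - (\<Sum>q\<in>{q\<in>S' - Sr. g q = g p}. z q))" for p
    have grp: "(\<Sum>p\<in>{p\<in>S - Sr. g p = w}. z1 p) = 0" if w: "w \<in> W" for w
    proof -
      have "rep w \<notin> S'" using w by (auto simp: S'_def)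
      then have "z1 (rep w) = - (\<Sum>p\<in>{p\<in>S' - Sr. g p = w}. z p)"
        using rep(2)[OF w] by (simp add: z1_def)
      moreover have "(\<Sum>p\<in>{p\<in>S' - Sr. g p = w}. z1 p) = (\<Sum>p\<in>{p\<in>S' - Sr. g p = w}. z p)"
        by (intro sum.cong) (auto simp: z1_def)
      ultimately show ?thesis using group[OF w, of z1] by simp
    qed
    have "(\<Sum>p\<in>S. z1 p * of_bool (u \<in> inc p)) = 0" if "u \<in> U" for u
      using reduce[of z1 0 u, OF grp] z that by (simp add: z1_def)
    then have "\<forall>p\<in>S. z1 p = 0" using grp by (intro ind) (auto simp: W_def)
    then show ?thesis by (auto simp: z1_def S'_def)
  qed
  have cardS': "card S' \<le> card U" by (rule integer_system_denominator(1)[OF S' U, of c, OF ind'])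
  obtain k :: int where k: "0 < k" "k \<le> (\<Prod>p\<in>S'. \<Sum>u\<in>U. \<bar>c p u\<bar>)"
    and kint: "\<And>y :: 'p \<Rightarrow> real. \<forall>u\<in>U. (\<Sum>p\<in>S'. y p * of_int (c p u)) \<in> \<int> \<Longrightarrow> \<forall>p\<in>S'. of_int k * y p \<in> \<int>"
    using integer_system_denominator(2)[OF S' U, of c, OF ind'] by blast
  have "2 * x p * of_int k \<in> \<int>" if "p \<in> S'" for p
  proof -
    have "(\<Sum>p\<in>S'. (2 * x p) * of_int (c p u)) \<in> \<int>" if "u \<in> U" for u
    proof -
      have "(\<Sum>p\<in>S'. (2 * x p) * of_int (c p u)) = 2 * (\<Sum>p\<in>S'. x p * of_int (c p u))"
        by (simp add: sum_distrib_left mult.assoc)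
      also have "\<dots> = 2 - (\<Sum>w\<in>W. of_bool (u \<in> inc (rep w)))"
        using reduce[of x "1/2" u] x_leaf[OF that] x_group by (simp add: W_def)
      also have "\<dots> \<in> \<int>" by (intro Ints_diff Ints_sum) (auto simp: of_bool_def)
      finally show ?thesis .
    qed
    then show ?thesis using kint[of "\<lambda>p. 2 * x p"] that by (auto simp: mult.commute)
  qed
  note int' = this
  define K where "K = nat (2 * k)"
  have K: "real K = 2 * of_int k" using k by (simp add: K_def)
  have "real K * x p \<in> \<int>" if p: "p \<in> S" for p
  proof (cases "p \<in> S'")
    case True
    then show ?thesis using int'[OF True] by (simp add: K mult_ac)
  next
    case False
    then obtain w where w: "w \<in> W" "p = rep w" using p by (auto simp: S'_def)
    have "x p = 1 / 2 - (\<Sum>p\<in>{p\<in>S' - Sr. g p = w}. x p)"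
      using group[OF w(1), of x] x_group[of w] w by (simp add: W_def)
    then have "real K * x p = of_int k - (\<Sum>p\<in>{p\<in>S' - Sr. g p = w}. 2 * x p * of_int k)"
      by (simp add: K right_diff_distrib sum_distrib_left mult_ac)
    also have "\<dots> \<in> \<int>" using int' by (intro Ints_diff Ints_sum) auto
    finally show ?thesis .
  qed
  moreover have "k \<le> 4 ^ (card U - 2)"
  proof -
    have cnt: "(\<Sum>u\<in>U. of_bool (u \<in> inc p) :: int) = int (card (inc p))" if "p \<in> S" for p
      using inc[OF that] U by (simp add: of_bool_def Int_absorb1 Int_absorb2 sum.If_cases)
    have one: "(\<Sum>u\<in>U. \<bar>c p u\<bar>) \<le> (if p \<in> Sr then 1 else 4)" if p: "p \<in> S'" for p
    proof (cases "p \<in> Sr")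
      case True
      then show ?thesis using cnt[of p] inc1[of p] p by (simp add: c_def S'_def)
    next
      case False
      have pS: "p \<in> S - Sr" using p False by (simp add: S'_def)
      have "(\<Sum>u\<in>U. \<bar>c p u\<bar>) \<le> (\<Sum>u\<in>U. of_bool (u \<in> inc p) + of_bool (u \<in> inc (rep (g p))))"
        by (intro sum_mono) (auto simp: c_def)
      also have "\<dots> = 4"
        using pS rep(1)[OF gW[OF pS]] by (simp add: sum.distrib cnt inc2)
      finally show ?thesis using False by simp
    qed
    have "(\<Prod>p\<in>S'. \<Sum>u\<in>U. \<bar>c p u\<bar>) \<le> (\<Prod>p\<in>S'. if p \<in> Sr then 1 else 4)"
      using one by (intro prod_mono) (auto intro: sum_nonneg)
    also have "\<dots> = (\<Prod>p\<in>S' - Sr. 4)"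
      using S' by (intro prod.mono_neutral_cong_right) auto
    also have "\<dots> = 4 ^ card (S' - Sr)" by simp
    also have "\<dots> \<le> 4 ^ (card U - 2)"
    proof (rule power_increasing)
      show "card (S' - Sr) \<le> card U - 2"
        using cardS' Sr2 SrS' S' by (simp add: card_Diff_subset finite_subset)
    qed simp
    finally show ?thesis using k(2) by linarith
  qed
  then have "K \<le> 2 * 4 ^ (card U - 2)" unfolding K_def by (simp add: nat_le_iff)
  moreover have "0 < K" using k(1) by (simp add: K_def)
  ultimately show ?thesis by blast
qed

section \<open>Rooted trees and weights on pairs of leaves\<close>

datatype 'a leaf_tree = Leaf 'a | Node "'a leaf_tree" "'a leaf_tree"

primrec leaves :: "'a leaf_tree \<Rightarrow> 'a set" where
  "leaves (Leaf x) = {x}"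
| "leaves (Node a b) = leaves a \<union> leaves b"

primrec subtrees :: "'a leaf_tree \<Rightarrow> 'a leaf_tree set" where
  "subtrees (Leaf x) = {Leaf x}"
| "subtrees (Node a b) = insert (Node a b) (subtrees a \<union> subtrees b)"

primrec distinct_leaves :: "'a leaf_tree \<Rightarrow> bool" where
  "distinct_leaves (Leaf x) \<longleftrightarrow> True"
| "distinct_leaves (Node a b) \<longleftrightarrow> distinct_leaves a \<and> distinct_leaves b \<and> leaves a \<inter> leaves b = {}"

lemma finite_leaves [simp]: "finite (leaves t)"
  by (induction t) auto

lemma leaves_nonempty [simp]: "leaves t \<noteq> {}"
  by (induction t) auto

lemma subtrees_refl [simp]: "t \<in> subtrees t"
  by (cases t) auto

lemma leaves_subtree: "t \<in> subtrees T \<Longrightarrow> leaves t \<subseteq> leaves T"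
  by (induction T) auto

lemma leaf_subtree_iff: "Leaf u \<in> subtrees T \<longleftrightarrow> u \<in> leaves T"
  by (induction T) auto

lemma distinct_leaves_subtree: "t \<in> subtrees T \<Longrightarrow> distinct_leaves T \<Longrightarrow> distinct_leaves t"
  by (induction T) auto

lemma subtrees_trans: "s \<in> subtrees t \<Longrightarrow> t \<in> subtrees T \<Longrightarrow> s \<in> subtrees T"
  by (induction T) auto

lemma children_subtrees:
  assumes "Node a b \<in> subtrees T"
  shows "a \<in> subtrees T" "b \<in> subtrees T"
  using assms subtrees_trans[of _ "Node a b" T] by auto

text \<open>
  The total weight between \<open>A\<close> and \<open>B\<close>, which is the weight of the pairs with one point in each when
  \<open>A\<close> and \<open>B\<close> are disjoint.
\<close>

definition cross :: "('a set \<Rightarrow> real) \<Rightarrow> 'a set \<Rightarrow> 'a set \<Rightarrow> real" where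
  "cross x A B = (\<Sum>u\<in>A. \<Sum>v\<in>B. x {u, v})"

lemma cross_commute: "cross x A B = cross x B A"
  unfolding cross_def by (subst sum.swap) (simp add: insert_commute)

lemma cross_Un_left:
  assumes "finite A" "finite B" "A \<inter> B = {}"
  shows "cross x (A \<union> B) C = cross x A C + cross x B C"
  using assms by (simp add: cross_def sum.union_disjoint)

lemma cross_Un_right:
  assumes "finite A" "finite B" "A \<inter> B = {}"
  shows "cross x C (A \<union> B) = cross x C A + cross x C B"
  using cross_Un_left[OF assms] by (simp add: cross_commute[of x C])

text \<open>
  Weight between \<open>A\<close> and \<open>B\<close> crosses the cuts around \<open>A\<close> and around \<open>B\<close>, but not the cut around
  their union. All other weight crosses as many cuts on the left as on the right.
\<close>

lemma cut_split:
  assumes "finite M" "A \<subseteq> M" "B \<subseteq> M" "A \<inter> B = {}"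
  shows "cross x (A \<union> B) (M - (A \<union> B)) + 2 * cross x A B = cross x A (M - A) + cross x B (M - B)"
proof -
  define R where "R = M - (A \<union> B)"
  have fin: "finite A" "finite B" "finite R"
    using assms finite_subset by (auto simp: R_def)
  have "M - A = B \<union> R" "M - B = A \<union> R" using assms by (auto simp: R_def)
  moreover have "B \<inter> R = {}" "A \<inter> R = {}" by (auto simp: R_def)
  ultimately show ?thesis
    using fin assms(4) by (simp add: R_def[symmetric] cross_Un_left cross_Un_right cross_commute[of x B A])
qed

text \<open>
  By \<open>cut_split\<close>, the weight \<open>w\<close> between the branches satisfies \<open>c + 2 * w = c + c\<close>.
\<close>

lemma node_equation:
  assumes "finite M" "distinct_leaves T" "leaves T \<subseteq> M"
    and eq: "\<And>t. t \<in> subtrees T \<Longrightarrow> cross x (leaves t) (M - leaves t) = c"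
    and ab: "Node a b \<in> subtrees T"
  shows "cross x (leaves a) (leaves b) = c / 2"
proof -
  have "leaves a \<inter> leaves b = {}" using distinct_leaves_subtree[OF ab] assms(2) by simp
  moreover have "leaves a \<subseteq> M" "leaves b \<subseteq> M" using leaves_subtree[OF ab] assms(3) by auto
  ultimately show ?thesis
    using cut_split[of M "leaves a" "leaves b" x] assms(1) eq[OF ab] eq[of a] eq[of b] children_subtrees[OF ab]
    by simp
qed

text \<open>
  The converse of \<open>node_equation\<close>. It holds for every \<open>c\<close>: the value \<open>1\<close> describes
  feasible weights, the value \<open>0\<close> linear dependencies between the columns.
\<close>

lemma cut_equations:
  assumes M: "finite M"
    and "distinct_leaves T" "leaves T \<subseteq> M"
    and "\<And>u. u \<in> leaves T \<Longrightarrow> cross x {u} (M - {u}) = c"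
    and "\<And>a b. Node a b \<in> subtrees T \<Longrightarrow> cross x (leaves a) (leaves b) = c / 2"
    and "t \<in> subtrees T"
  shows "cross x (leaves t) (M - leaves t) = c"
  using assms(2-)
proof (induction T arbitrary: t)
  case (Leaf u)
  then show ?case by simp
next
  case (Node a b)
  have IH: "cross x (leaves s) (M - leaves s) = c" if "s \<in> subtrees a \<or> s \<in> subtrees b" for s
    using that
  proof
    assume "s \<in> subtrees a"
    then show ?thesis using Node.prems by (intro Node.IH(1)) auto
  next
    assume "s \<in> subtrees b"
    then show ?thesis using Node.prems by (intro Node.IH(2)) auto
  qed
  show ?case
  proof (cases "t = Node a b")
    case True
    have "cross x (leaves a) (leaves b) = c / 2" by (rule Node.prems) simp
    then show ?thesis
      using cut_split[OF M, of "leaves a" "leaves b" x] IH[of a] IH[of b] Node.prems True by simp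
  next
    case False
    then show ?thesis using IH Node.prems by auto
  qed
qed

definition pairs :: "'a set \<Rightarrow> 'a set set" where
  "pairs M = {p. p \<subseteq> M \<and> card p = 2}"

definition joins :: "'a set \<Rightarrow> 'a set \<Rightarrow> 'a set \<Rightarrow> bool" where
  "joins A B p \<longleftrightarrow> p \<inter> A \<noteq> {} \<and> p \<inter> B \<noteq> {}"

lemma finite_pairs: "finite M \<Longrightarrow> finite (pairs M)"
  by (simp add: pairs_def)

lemma pair_in_pairs: "{u, v} \<in> pairs M \<longleftrightarrow> u \<in> M \<and> v \<in> M \<and> u \<noteq> v"
  by (auto simp: pairs_def card_insert_if)

lemma pairsE:
  assumes "p \<in> pairs M"
  obtains u v where "p = {u, v}" "u \<in> M" "v \<in> M" "u \<noteq> v"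
  using assms by (auto simp: pairs_def card_2_iff)

lemma sum_joining_pairs:
  assumes "finite M" "A \<subseteq> M" "B \<subseteq> M" "A \<inter> B = {}"
  shows "(\<Sum>p\<in>pairs M. x p * of_bool (joins A B p)) = cross x A B"
proof -
  have "cross x A B = (\<Sum>(u, v)\<in>A \<times> B. x {u, v})"
    unfolding cross_def by (rule sum.cartesian_product)
  also have "\<dots> = (\<Sum>p\<in>(\<lambda>(u, v). {u, v}) ` (A \<times> B). x p)"
  proof (subst sum.reindex)
    show "inj_on (\<lambda>(u, v). {u, v}) (A \<times> B)"
      using assms(4) by (auto simp: inj_on_def doubleton_eq_iff)
  qed (auto intro!: sum.cong)
  also have "(\<lambda>(u, v). {u, v}) ` (A \<times> B) = {p \<in> pairs M. joins A B p}"
  proof (intro equalityI subsetI)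
    fix p assume "p \<in> (\<lambda>(u, v). {u, v}) ` (A \<times> B)"
    then show "p \<in> {p \<in> pairs M. joins A B p}"
      using assms by (auto simp: pair_in_pairs joins_def)
  next
    fix p assume "p \<in> {p \<in> pairs M. joins A B p}"
    then obtain u v where p: "p = {u, v}" and "joins A B p" by (auto elim: pairsE)
    then have "(u \<in> A \<and> v \<in> B) \<or> (v \<in> A \<and> u \<in> B)"
      using assms(4) by (auto simp: joins_def)
    then show "p \<in> (\<lambda>(u, v). {u, v}) ` (A \<times> B)"
      using p by (auto simp: image_iff insert_commute)
  qed
  also have "(\<Sum>p\<in>{p \<in> pairs M. joins A B p}. x p) = (\<Sum>p\<in>pairs M. x p * of_bool (joins A B p))"
    using finite_pairs[OF assms(1)] by (intro sum.mono_neutral_cong_left) auto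
  finally show ?thesis by simp
qed

text \<open>
  Send a unit of weight from the root down the tree and halve it at every branching: \<open>h u\<close> is what
  arrives at the leaf \<open>u\<close>. The unit that \<open>u\<close> has to exchange splits into \<open>h u\<close>, which leaves the tree
  through its root, and the weights \<open>h1 u * h2 v / 2\<close> exchanged with leaves \<open>v\<close> of the other branch at
  an ancestor of \<open>u\<close>.
\<close>

lemma tree_weights:
  assumes "distinct_leaves T"
  shows "\<exists>(h :: 'a \<Rightarrow> real) x. (\<forall>u. 0 \<le> h u) \<and> (\<forall>p. 0 \<le> x p) \<and> (\<Sum>u\<in>leaves T. h u) = 1 \<and>
    (\<forall>u\<in>leaves T. cross x {u} (leaves T - {u}) = 1 - h u) \<and>
    (\<forall>a b. Node a b \<in> subtrees T \<longrightarrow> cross x (leaves a) (leaves b) = 1 / 2)"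
  using assms
proof (induction T)
  case (Leaf r)
  show ?case
    by (intro exI[of _ "\<lambda>_. 1"] exI[of _ "\<lambda>_. 0"]) (simp add: cross_def)
next
  case (Node a b)
  obtain h1 x1 where Ha: "(\<forall>u. 0 \<le> h1 u) \<and> (\<forall>p. 0 \<le> x1 p) \<and> (\<Sum>u\<in>leaves a. h1 u) = 1 \<and>
    (\<forall>u\<in>leaves a. cross x1 {u} (leaves a - {u}) = 1 - h1 u) \<and>
    (\<forall>c d. Node c d \<in> subtrees a \<longrightarrow> cross x1 (leaves c) (leaves d) = 1 / 2)"
    using Node.IH(1) Node.prems by (simp only: distinct_leaves.simps) blast
  have 1: "\<And>u. 0 \<le> h1 u" "\<And>p. 0 \<le> x1 p" "(\<Sum>u\<in>leaves a. h1 u) = 1"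
    "\<And>u. u \<in> leaves a \<Longrightarrow> cross x1 {u} (leaves a - {u}) = 1 - h1 u"
    "\<And>c d. Node c d \<in> subtrees a \<Longrightarrow> cross x1 (leaves c) (leaves d) = 1 / 2"
    using Ha by blast+
  obtain h2 x2 where Hb: "(\<forall>u. 0 \<le> h2 u) \<and> (\<forall>p. 0 \<le> x2 p) \<and> (\<Sum>u\<in>leaves b. h2 u) = 1 \<and>
    (\<forall>u\<in>leaves b. cross x2 {u} (leaves b - {u}) = 1 - h2 u) \<and>
    (\<forall>c d. Node c d \<in> subtrees b \<longrightarrow> cross x2 (leaves c) (leaves d) = 1 / 2)"
    using Node.IH(2) Node.prems by (simp only: distinct_leaves.simps) blast
  have 2: "\<And>u. 0 \<le> h2 u" "\<And>p. 0 \<le> x2 p" "(\<Sum>u\<in>leaves b. h2 u) = 1"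
    "\<And>u. u \<in> leaves b \<Longrightarrow> cross x2 {u} (leaves b - {u}) = 1 - h2 u"
    "\<And>c d. Node c d \<in> subtrees b \<Longrightarrow> cross x2 (leaves c) (leaves d) = 1 / 2"
    using Hb by blast+
  have disj: "leaves a \<inter> leaves b = {}" using Node.prems by simp
  define h where "h u = (if u \<in> leaves a then h1 u / 2 else h2 u / 2)" for u
  define x where "x p = (if p \<subseteq> leaves a then x1 p else if p \<subseteq> leaves b then x2 p
    else (\<Sum>u\<in>p \<inter> leaves a. h1 u) * (\<Sum>v\<in>p \<inter> leaves b. h2 v) / 2)" for p
  have xa: "cross x C D = cross x1 C D" if "C \<subseteq> leaves a" "D \<subseteq> leaves a" for C D
    unfolding cross_def using that by (intro sum.cong) (auto simp: x_def)
  have xb: "cross x C D = cross x2 C D" if "C \<subseteq> leaves b" "D \<subseteq> leaves b" for C D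
    unfolding cross_def using that disj by (intro sum.cong) (auto simp: x_def)
  have xab: "x {u, v} = h1 u * h2 v / 2" if "u \<in> leaves a" "v \<in> leaves b" for u v
  proof -
    have "{u, v} \<inter> leaves a = {u}" "{u, v} \<inter> leaves b = {v}" "u \<notin> leaves b" "v \<notin> leaves a"
      using that disj by auto
    then show ?thesis by (simp add: x_def)
  qed
  have half: "(\<Sum>u\<in>C. \<Sum>v\<in>D. x {u, v}) = (\<Sum>u\<in>C. h1 u) * (\<Sum>v\<in>D. h2 v) / 2"
    if "C \<subseteq> leaves a" "D \<subseteq> leaves b" for C D
  proof -
    have "(\<Sum>u\<in>C. \<Sum>v\<in>D. x {u, v}) = (\<Sum>u\<in>C. \<Sum>v\<in>D. h1 u * h2 v / 2)"
      by (intro sum.cong refl xab) (use that in auto)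
    then show ?thesis by (simp add: sum_product sum_divide_distrib)
  qed
  have "0 \<le> h u" for u using 1(1) 2(1) by (simp add: h_def)
  moreover have "0 \<le> x p" for p
    using 1(1,2) 2(1,2) by (auto simp: x_def intro!: sum_nonneg mult_nonneg_nonneg)
  moreover have "(\<Sum>u\<in>leaves (Node a b). h u) = 1"
  proof -
    have "(\<Sum>u\<in>leaves a. h u) = (\<Sum>u\<in>leaves a. h1 u) / 2"
      unfolding sum_divide_distrib by (intro sum.cong) (auto simp: h_def)
    moreover have "(\<Sum>u\<in>leaves b. h u) = (\<Sum>u\<in>leaves b. h2 u) / 2"
      unfolding sum_divide_distrib using disj by (intro sum.cong) (auto simp: h_def)
    ultimately show ?thesis using 1(3) 2(3) disj by (simp add: sum.union_disjoint)
  qed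
  moreover have "cross x {u} (leaves (Node a b) - {u}) = 1 - h u" if "u \<in> leaves (Node a b)" for u
  proof (cases "u \<in> leaves a")
    case True
    then have "leaves (Node a b) - {u} = (leaves a - {u}) \<union> leaves b" using disj by auto
    moreover have "(leaves a - {u}) \<inter> leaves b = {}" using disj by auto
    moreover have "cross x {u} (leaves b) = h1 u / 2"
      unfolding cross_def using half[of "{u}" "leaves b"] True 2(3) by simp
    moreover have "cross x {u} (leaves a - {u}) = 1 - h1 u" using 1(4) True by (subst xa) auto
    ultimately show ?thesis using True by (simp add: cross_Un_right h_def)
  next
    case False
    then have u: "u \<in> leaves b" using that by simp
    have "leaves (Node a b) - {u} = leaves a \<union> (leaves b - {u})" using False by auto
    moreover have "leaves a \<inter> (leaves b - {u}) = {}" using disj by auto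
    moreover have "cross x {u} (leaves a) = h2 u / 2"
      unfolding cross_commute[of x "{u}"] using half[of "leaves a" "{u}"] u 1(3) by (simp add: cross_def)
    moreover have "cross x {u} (leaves b - {u}) = 1 - h2 u" using 2(4) u by (subst xb) auto
    ultimately show ?thesis using False by (simp add: cross_Un_right h_def)
  qed
  moreover have "cross x (leaves c) (leaves d) = 1 / 2" if cd: "Node c d \<in> subtrees (Node a b)" for c d
  proof -
    consider "c = a" "d = b" | "Node c d \<in> subtrees a" | "Node c d \<in> subtrees b" using cd by auto
    then show ?thesis
    proof cases
      case 1
      then show ?thesis using half[of "leaves a" "leaves b"] \<open>sum h1 (leaves a) = 1\<close> 2(3) by (simp add: cross_def)
    next
      case 2
      then show ?thesis using leaves_subtree[OF 2] by (subst xa) (auto simp: 1(5))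
    next
      case 3
      then show ?thesis using leaves_subtree[OF 3] by (subst xb) (auto simp: 2(5))
    qed
  qed
  ultimately show ?case by (intro exI[of _ h] exI[of _ x]) blast
qed

lemma fractional_tour_exists:
  assumes "distinct_leaves T" "r \<notin> leaves T" "M = insert r (leaves T)"
  shows "\<exists>x. (\<forall>p. 0 \<le> x p) \<and> (\<forall>t\<in>subtrees T. cross x (leaves t) (M - leaves t) = 1)"
proof -
  obtain h y where Hh: "(\<forall>u. 0 \<le> h u) \<and> (\<forall>p. 0 \<le> y p) \<and> (\<Sum>u\<in>leaves T. h u) = 1 \<and>
    (\<forall>u\<in>leaves T. cross y {u} (leaves T - {u}) = 1 - h u) \<and>
    (\<forall>c d. Node c d \<in> subtrees T \<longrightarrow> cross y (leaves c) (leaves d) = 1 / 2)"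
    using tree_weights[OF assms(1)] by blast
  have h: "\<And>u. 0 \<le> h u" "\<And>p. 0 \<le> y p" "(\<Sum>u\<in>leaves T. h u) = 1"
    "\<And>u. u \<in> leaves T \<Longrightarrow> cross y {u} (leaves T - {u}) = 1 - h u"
    "\<And>a b. Node a b \<in> subtrees T \<Longrightarrow> cross y (leaves a) (leaves b) = 1 / 2"
    using Hh by blast+
  define x where "x p = (if r \<in> p then (\<Sum>u\<in>p - {r}. h u) else y p)" for p
  have xy: "cross x C D = cross y C D" if "C \<subseteq> leaves T" "D \<subseteq> leaves T" for C D
    unfolding cross_def using that assms(2) by (intro sum.cong refl) (auto simp: x_def)
  have "cross x (leaves t) (M - leaves t) = 1" if t: "t \<in> subtrees T" for t
  proof (rule cut_equations[of M T])
    show "finite M" "leaves T \<subseteq> M" "t \<in> subtrees T" "distinct_leaves T" using assms t by auto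
  next
    fix u assume u: "u \<in> leaves T"
    have "M - {u} = insert r (leaves T - {u})" using u assms by auto
    then have "cross x {u} (M - {u}) = x {u, r} + cross x {u} (leaves T - {u})"
      using assms(2) by (simp add: cross_def)
    also have "{u, r} - {r} = {u}" using u assms(2) by auto
    then have "x {u, r} = h u" by (simp add: x_def)
    finally show "cross x {u} (M - {u}) = 1" using u by (subst (asm) xy) (auto simp: h(4))
  next
    fix a b assume ab: "Node a b \<in> subtrees T"
    show "cross x (leaves a) (leaves b) = 1 / 2"
      using leaves_subtree[OF ab] by (subst xy) (auto simp: h(5)[OF ab])
  qed
  then show ?thesis using h(1,2) by (intro exI[of _ x]) (auto simp: x_def intro: sum_nonneg)
qed

text \<open>
  The leaves of a subtree are connected by induction: the node equation gives positive
  weight between the two branches. The root is attached by the equation of the topmost edge.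
\<close>

lemma support_connected:
  assumes "finite M" "distinct_leaves T" "r \<notin> leaves T" "M = insert r (leaves T)"
    and eq: "\<And>t. t \<in> subtrees T \<Longrightarrow> cross x (leaves t) (M - leaves t) = 1"
    and "u \<in> M" "v \<in> M"
  shows "(u, v) \<in> {(u, v). u \<in> M \<and> v \<in> M \<and> u \<noteq> v \<and> x {u, v} \<noteq> 0}\<^sup>*"
proof -
  define R where "R = {(u, v). u \<in> M \<and> v \<in> M \<and> u \<noteq> v \<and> x {u, v} \<noteq> 0}"
  have sym: "sym (R\<^sup>*)" by (intro sym_rtrancl) (auto simp: R_def sym_def insert_commute)
  have bridge: "\<exists>u\<in>A. \<exists>v\<in>B. (u, v) \<in> R"
    if AB: "cross x A B \<noteq> 0" "A \<subseteq> M" "B \<subseteq> M" "A \<inter> B = {}" for A B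
  proof -
    obtain u where u: "u \<in> A" "(\<Sum>v\<in>B. x {u, v}) \<noteq> 0"
      using sum.not_neutral_contains_not_neutral[OF AB(1)[unfolded cross_def]] by blast
    obtain v where "v \<in> B" "x {u, v} \<noteq> 0"
      using sum.not_neutral_contains_not_neutral[OF u(2)] by blast
    then show ?thesis using u AB unfolding R_def by blast
  qed
  have join: "\<forall>u\<in>A \<union> B. \<forall>v\<in>A \<union> B. (u, v) \<in> R\<^sup>*"
    if A: "\<forall>u\<in>A. \<forall>v\<in>A. (u, v) \<in> R\<^sup>*" and B: "\<forall>u\<in>B. \<forall>v\<in>B. (u, v) \<in> R\<^sup>*"
      and AB: "u0 \<in> A" "v0 \<in> B" "(u0, v0) \<in> R" for A B u0 v0
  proof -
    have "(u, v) \<in> R\<^sup>*" if "u \<in> A" "v \<in> B" for u v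
      using A B AB that by (meson r_into_rtrancl rtrancl_trans)
    moreover from this have "(v, u) \<in> R\<^sup>*" if "u \<in> A" "v \<in> B" for u v
      using symD[OF sym] that by blast
    ultimately show ?thesis using A B by blast
  qed
  have conn: "\<forall>u\<in>leaves t. \<forall>v\<in>leaves t. (u, v) \<in> R\<^sup>*" if "t \<in> subtrees T" for t
    using that
  proof (induction t)
    case (Leaf u)
    then show ?case by simp
  next
    case (Node a b)
    have "cross x (leaves a) (leaves b) = 1 / 2"
      using assms Node.prems by (intro node_equation[of M T x 1]) auto
    moreover have "leaves a \<subseteq> M" "leaves b \<subseteq> M" using leaves_subtree[OF Node.prems] assms(4) by auto
    moreover have "leaves a \<inter> leaves b = {}" using distinct_leaves_subtree[OF Node.prems] assms(2) by simp
    ultimately obtain u0 v0 where "u0 \<in> leaves a" "v0 \<in> leaves b" "(u0, v0) \<in> R"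
      using bridge[of "leaves a" "leaves b"] by auto
    then show ?case
      using join[of "leaves a" "leaves b"] Node.IH children_subtrees[OF Node.prems] by simp
  qed
  have "cross x (leaves T) {r} = 1" using eq[of T] assms(3,4) by (simp add: insert_Diff_if)
  then obtain u0 where "u0 \<in> leaves T" "(u0, r) \<in> R"
    using bridge[of "leaves T" "{r}"] assms(3,4) by auto
  then have "\<forall>u\<in>leaves T \<union> {r}. \<forall>v\<in>leaves T \<union> {r}. (u, v) \<in> R\<^sup>*"
    using conn[of T] by (intro join[of _ _ u0 r]) auto
  then have "(u, v) \<in> R\<^sup>*" using assms(4,6,7) by blast
  then show ?thesis by (simp only: R_def)
qed

primrec lca :: "'a leaf_tree \<Rightarrow> 'a set \<Rightarrow> 'a leaf_tree" where
  "lca (Leaf x) p = Leaf x"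
| "lca (Node a b) p = (if p \<subseteq> leaves a then lca a p else if p \<subseteq> leaves b then lca b p else Node a b)"

lemma lca_Node:
  assumes "distinct_leaves T" "p \<in> pairs (leaves T)"
  shows "\<exists>a b. lca T p = Node a b \<and> Node a b \<in> subtrees T"
  using assms
proof (induction T)
  case (Leaf x)
  then show ?case by (auto simp: pairs_def subset_singleton_iff)
next
  case (Node a b)
  then show ?case by (auto simp: pairs_def)
qed

lemma lca_eq_iff:
  assumes "distinct_leaves T" "p \<in> pairs (leaves T)" "Node a b \<in> subtrees T"
  shows "lca T p = Node a b \<longleftrightarrow> joins (leaves a) (leaves b) p"
  using assms
proof (induction T)
  case (Leaf x)
  then show ?case by simp
next
  case (Node c d)
  have disj: "leaves c \<inter> leaves d = {}" using Node.prems by simp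
  have p: "p \<subseteq> leaves c \<union> leaves d" "p \<noteq> {}" using Node.prems by (auto simp: pairs_def)
  have root: "Node c d \<notin> subtrees c" "Node c d \<notin> subtrees d"
    using leaves_subtree[of "Node c d" c] leaves_subtree[of "Node c d" d] leaves_nonempty[of c] leaves_nonempty[of d] disj
    unfolding leaves.simps by blast+
  have inner: "lca c p \<in> subtrees c" for c :: "'a leaf_tree" and p by (induction c) auto
  consider "p \<subseteq> leaves c" | "p \<subseteq> leaves d" | "joins (leaves c) (leaves d) p"
    using p by (auto simp: joins_def)
  then show ?case
  proof cases
    case 1
    then have pc: "p \<in> pairs (leaves c)" using Node.prems by (simp add: pairs_def)
    show ?thesis
    proof (cases "Node a b \<in> subtrees c")
      case True
      then show ?thesis using Node.IH(1)[OF _ pc] Node.prems 1 by simp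
    next
      case False
      then have "lca (Node c d) p \<noteq> Node a b" using 1 inner[of c p] by auto
      moreover have "\<not> joins (leaves a) (leaves b) p"
        using False Node.prems(3) leaves_subtree[of "Node a b" d] 1 disj by (auto simp: joins_def)
      ultimately show ?thesis by blast
    qed
  next
    case 2
    then have pc: "p \<in> pairs (leaves d)" using Node.prems by (simp add: pairs_def)
    have nc: "\<not> p \<subseteq> leaves c" using 2 p disj by auto
    show ?thesis
    proof (cases "Node a b \<in> subtrees d")
      case True
      then show ?thesis using Node.IH(2)[OF _ pc] Node.prems 2 nc by simp
    next
      case False
      then have "lca (Node c d) p \<noteq> Node a b" using 2 nc inner[of d p] by auto
      moreover have "\<not> joins (leaves a) (leaves b) p"
        using False Node.prems(3) leaves_subtree[of "Node a b" c] 2 disj by (auto simp: joins_def)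
      ultimately show ?thesis by blast
    qed
  next
    case 3
    then have "\<not> p \<subseteq> leaves c" "\<not> p \<subseteq> leaves d" using disj by (auto simp: joins_def)
    then have "lca (Node c d) p = Node c d" by simp
    moreover have "\<not> joins (leaves a) (leaves b) p"
      if ab: "Node a b \<in> subtrees c \<or> Node a b \<in> subtrees d"
    proof -
      have "leaves a \<inter> leaves b = {}"
        using distinct_leaves_subtree[OF Node.prems(3,1)] by simp
      moreover obtain u v where "p = {u, v}" "u \<in> leaves c" "v \<in> leaves d"
        using 3 Node.prems(2) disj by (auto simp: joins_def elim!: pairsE)
      moreover have "leaves a \<union> leaves b \<subseteq> leaves c \<or> leaves a \<union> leaves b \<subseteq> leaves d"
        using ab leaves_subtree[of "Node a b"] by fastforce
      ultimately show ?thesis using disj unfolding joins_def by blast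
    qed
    ultimately show ?thesis using Node.prems(3) root 3 by auto
  qed
qed

section \<open>Binary trees as rooted trees\<close>

text \<open>
  Reachability by walks. Unlike paths, walks compose, and \<open>graph_path_iff_reach\<close> translates
  between the two.
\<close>

definition reach :: "'a set set \<Rightarrow> ('a \<times> 'a) set" where
  "reach E = {(x, y). {x, y} \<in> E}\<^sup>*"

lemma reach_refl [simp]: "(u, u) \<in> reach E"
  by (simp add: reach_def)

lemma reach_trans: "(u, v) \<in> reach E \<Longrightarrow> (v, w) \<in> reach E \<Longrightarrow> (u, w) \<in> reach E"
  by (simp add: reach_def)

lemma reach_edge: "{u, v} \<in> E \<Longrightarrow> (u, v) \<in> reach E"
  by (auto simp: reach_def)

lemma reach_sym: "(u, v) \<in> reach E \<Longrightarrow> (v, u) \<in> reach E"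
  unfolding reach_def by (rule symD[OF sym_rtrancl]) (auto simp: sym_def insert_commute)

lemma reach_mono: "E' \<subseteq> E \<Longrightarrow> (u, v) \<in> reach E' \<Longrightarrow> (u, v) \<in> reach E"
  using rtrancl_mono[of "{(x, y). {x, y} \<in> E'}" "{(x, y). {x, y} \<in> E}"]
  by (auto simp: reach_def)

lemma path_reach:
  assumes "successively (\<lambda>x y. {x, y} \<in> E) p" "p \<noteq> []"
  shows "(hd p, last p) \<in> reach E"
  using assms
proof (induction p)
  case (Cons x p)
  then show ?case
    by (cases p) (auto simp: successively_Cons intro: reach_trans[OF reach_edge])
qed simp

lemma reach_imp_path:
  assumes "\<And>e. e \<in> E \<Longrightarrow> e \<subseteq> V" "(u, v) \<in> reach E" "v \<in> V"
  shows "\<exists>p. graph_path V E u p v"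
  using assms(2) unfolding reach_def
proof (induction rule: converse_rtrancl_induct)
  case base
  then show ?case using assms(3) by (intro exI[of _ "[v]"]) (simp add: graph_path_def)
next
  case (step u w)
  then obtain p where p: "graph_path V E w p v" by blast
  have uw: "{u, w} \<in> E" using step by simp
  show ?case
  proof (cases "u \<in> set p")
    case True
    then obtain xs ys where "p = xs @ u # ys" by (meson split_list)
    then have "graph_path V E u (u # ys) v"
      using p by (auto simp: graph_path_def successively_append_iff)
    then show ?thesis by blast
  next
    case False
    then have "graph_path V E u (u # p) v"
      using p uw assms(1)[OF uw] by (cases p) (auto simp: graph_path_def successively_Cons)
    then show ?thesis by blast
  qed
qed

lemma graph_path_reach: "graph_path V E u p v \<Longrightarrow> (u, v) \<in> reach E"
  using path_reach[of E p] by (simp add: graph_path_def)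

lemma graph_path_iff_reach:
  assumes "\<And>e. e \<in> E \<Longrightarrow> e \<subseteq> V" "v \<in> V"
  shows "(\<exists>p. graph_path V E u p v) \<longleftrightarrow> (u, v) \<in> reach E"
proof
  assume "\<exists>p. graph_path V E u p v"
  then show "(u, v) \<in> reach E" by (auto dest: graph_path_reach)
next
  assume "(u, v) \<in> reach E"
  then show "\<exists>p. graph_path V E u p v" using reach_imp_path[of E V u v] assms by blast
qed

locale finite_tree =
  fixes V :: "'a set" and E :: "'a set set"
  assumes tree: "graph_tree V E"
begin

lemma finite_V: "finite V"
  using tree by (simp add: graph_tree_def simple_graph_def)

lemma edge_subset: "e \<in> E \<Longrightarrow> e \<subseteq> V"
  using tree by (simp add: graph_tree_def simple_graph_def)

lemma finite_E: "finite E"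
  using edge_subset finite_V by (intro finite_subset[of E "Pow V"]) auto

lemma edge_ends:
  assumes "{u, v} \<in> E"
  shows "u \<in> V" "v \<in> V" "u \<noteq> v"
proof -
  have "card {u, v} = 2" using assms tree by (simp add: graph_tree_def simple_graph_def)
  then show "u \<noteq> v" by auto
qed (use edge_subset[OF assms] in auto)

lemma edge_doubleton: "e \<in> E \<Longrightarrow> \<exists>u v. e = {u, v} \<and> u \<noteq> v"
  using tree by (simp add: graph_tree_def simple_graph_def card_2_iff)

lemma connected_V:
  assumes "u \<in> V" "v \<in> V"
  shows "(u, v) \<in> reach E"
proof -
  obtain p where "graph_path V E u p v" using tree assms unfolding graph_tree_def by blast
  then show ?thesis by (rule graph_path_reach)
qed

text \<open>
  A path that bypasses an edge closes to a cycle with it.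
\<close>

lemma bridge:
  assumes "{u, v} \<in> E"
  shows "(u, v) \<notin> reach (E - {{u, v}})"
proof
  assume "(u, v) \<in> reach (E - {{u, v}})"
  then obtain p where p: "graph_path V (E - {{u, v}}) u p v"
    using reach_imp_path[of "E - {{u, v}}" V u v] edge_subset edge_ends(2)[OF assms] by auto
  obtain p' where p': "p = u # p'" "p' \<noteq> []"
    using p edge_ends(3)[OF assms] by (cases p) (auto simp: graph_path_def split: if_splits)
  obtain w q where q: "p' = w # q" using p'(2) by (cases p') auto
  have "q \<noteq> []" using p p' q by (auto simp: graph_path_def)
  then have "length p \<ge> 3" using p' q by (cases q) auto
  moreover have "successively (\<lambda>x y. {x, y} \<in> E) p"
    using p by (auto simp: graph_path_def elim: successively_mono)
  ultimately have "graph_cycle V E p"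
    using p assms by (auto simp: graph_cycle_def graph_path_def insert_commute)
  then show False using tree by (auto simp: graph_tree_def)
qed

lemma two_sides:
  assumes e: "{u, v} \<in> E" and "x \<in> V"
  shows "(u, x) \<in> reach (E - {{u, v}}) \<or> (v, x) \<in> reach (E - {{u, v}})"
proof -
  have "(u, x) \<in> reach E" using connected_V edge_ends[OF e] assms(2) by blast
  then show ?thesis unfolding reach_def
  proof (induction rule: rtrancl_induct)
    case (step y z)
    show ?case
    proof (cases "{y, z} = {u, v}")
      case True
      then have "z = u \<or> z = v" by (auto simp: doubleton_eq_iff)
      then show ?thesis by auto
    next
      case False
      then have "(y, z) \<in> {(x, y). {x, y} \<in> E - {{u, v}}}" using step by auto
      then show ?thesis using step.IH by (meson rtrancl.rtrancl_into_rtrancl)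
    qed
  qed simp
qed

lemma separated_iff:
  assumes "{a, b} \<in> E" "u \<in> V" "v \<in> V"
  shows "(u, v) \<in> reach (E - {{a, b}}) \<longleftrightarrow>
    ((a, u) \<in> reach (E - {{a, b}}) \<longleftrightarrow> (a, v) \<in> reach (E - {{a, b}}))"
proof
  assume "(u, v) \<in> reach (E - {{a, b}})"
  then show "(a, u) \<in> reach (E - {{a, b}}) \<longleftrightarrow> (a, v) \<in> reach (E - {{a, b}})"
    using reach_trans[of a u _ v] reach_trans[of a v _ u] reach_sym[of u v] by auto
next
  assume same: "(a, u) \<in> reach (E - {{a, b}}) \<longleftrightarrow> (a, v) \<in> reach (E - {{a, b}})"
  obtain c where "(c, u) \<in> reach (E - {{a, b}})" "(c, v) \<in> reach (E - {{a, b}})"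
    using two_sides[OF assms(1,2)] two_sides[OF assms(1,3)] same by blast
  then show "(u, v) \<in> reach (E - {{a, b}})"
    using reach_trans[of u c _ v] reach_sym[of c u] by simp
qed

lemma separated_iff_root:
  assumes e: "e \<in> E" and V: "r \<in> V" "u \<in> V" "v \<in> V"
  shows "(u, v) \<in> reach (E - {e}) \<longleftrightarrow>
    ((r, u) \<in> reach (E - {e}) \<longleftrightarrow> (r, v) \<in> reach (E - {e}))"
proof -
  obtain a b where ab: "e = {a, b}" using edge_doubleton[OF e] by blast
  have sep: "(x, y) \<in> reach (E - {e}) \<longleftrightarrow>
      ((a, x) \<in> reach (E - {e}) \<longleftrightarrow> (a, y) \<in> reach (E - {e}))" if "x \<in> V" "y \<in> V" for x y
    using separated_iff[OF e[unfolded ab] that] by (simp only: ab)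
  show ?thesis
    unfolding sep[OF V(2,3)] sep[OF V(1,2)] sep[OF V(1,3)]
    by (cases "(a, u) \<in> reach (E - {e})"; cases "(a, v) \<in> reach (E - {e})"; simp)
qed

text \<open>
  The two pieces of a path obtained by deleting an edge of it show that its ends lie on different
  sides of this edge. A path that does not use the edge stays on one side.
\<close>

lemma path_edges_separate:
  assumes p: "graph_path V E u p v"
  shows "path_edges p = {e \<in> E. (u, v) \<notin> reach (E - {e})}"
proof (intro equalityI subsetI)
  fix e assume "e \<in> path_edges p"
  then obtain i where i: "Suc i < length p" "e = {p ! i, p ! Suc i}"
    unfolding path_edges_def by blast
  define xs where "xs = take (Suc i) p"
  define ys where "ys = drop (Suc i) p"
  have split: "p = xs @ ys" by (simp add: xs_def ys_def)
  have ne: "xs \<noteq> []" "ys \<noteq> []" using i by (auto simp: xs_def ys_def)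
  have "hd p = u" "last p = v" using p by (auto simp: graph_path_def)
  then have "hd xs = u" "last ys = v" using ne by (simp_all add: split)
  moreover have "last xs = p ! i" using i ne by (simp add: xs_def last_conv_nth)
  moreover have "hd ys = p ! Suc i" using i by (simp add: ys_def hd_drop_conv_nth)
  ultimately have ends: "last xs = p ! i" "hd ys = p ! Suc i" "hd xs = u" "last ys = v" by auto
  have dist: "distinct (xs @ ys)" and succ: "successively (\<lambda>x y. {x, y} \<in> E) (xs @ ys)"
    using p split by (auto simp: graph_path_def)
  have succ': "successively (\<lambda>x y. {x, y} \<in> E) xs" "successively (\<lambda>x y. {x, y} \<in> E) ys"
    using succ by (simp_all add: successively_append_iff)
  have e: "e \<in> E" using succ ne ends i(2) by (auto simp: successively_append_iff)
  have "p ! i \<in> set xs" "p ! Suc i \<in> set ys" 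
    using last_in_set[OF ne(1)] hd_in_set[OF ne(2)] ends by simp_all
  then have notin: "p ! Suc i \<notin> set xs" "p ! i \<notin> set ys" using dist by auto
  have "successively (\<lambda>x y. {x, y} \<in> E - {e}) xs"
    by (rule successively_mono[OF succ'(1)]) (use notin i(2) in \<open>auto simp: doubleton_eq_iff\<close>)
  then have "(u, p ! i) \<in> reach (E - {e})" using path_reach[of "E - {e}" xs] ne ends by simp
  moreover have "successively (\<lambda>x y. {x, y} \<in> E - {e}) ys"
    by (rule successively_mono[OF succ'(2)]) (use notin i(2) in \<open>auto simp: doubleton_eq_iff\<close>)
  then have "(p ! Suc i, v) \<in> reach (E - {e})" using path_reach[of "E - {e}" ys] ne ends by simp
  ultimately have "(u, v) \<notin> reach (E - {e})"
    using bridge[of "p ! i" "p ! Suc i"] e i(2) reach_trans[of "p ! i" u _ v] reach_trans[of "p ! i" v _ "p ! Suc i"]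
      reach_sym[of u "p ! i"] reach_sym[of "p ! Suc i" v] by blast
  then show "e \<in> {e \<in> E. (u, v) \<notin> reach (E - {e})}" using e by simp
next
  fix e assume e: "e \<in> {e \<in> E. (u, v) \<notin> reach (E - {e})}"
  show "e \<in> path_edges p"
  proof (rule ccontr)
    assume no: "e \<notin> path_edges p"
    have "successively (\<lambda>x y. {x, y} \<in> E - {e}) p"
      using p no unfolding graph_path_def successively_conv_nth path_edges_def by blast
    then have "(u, v) \<in> reach (E - {e})" using p path_reach[of "E - {e}" p] by (simp add: graph_path_def)
    then show False using e by simp
  qed
qed

lemma path_singleton:
  assumes "graph_path V E v (v # p) v"
  shows "p = []"
proof (rule ccontr)
  have p: "last (v # p) = v" "distinct (v # p)" using assms unfolding graph_path_def by blast+
  assume "p \<noteq> []"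
  then have "last (v # p) \<in> set p" by simp
  then show False using p by simp
qed

lemma path_tail:
  assumes "graph_path V E u (u # a # p) v"
  shows "graph_path V E a (a # p) v"
proof -
  have "last (u # a # p) = v" "set (u # a # p) \<subseteq> V" "distinct (u # a # p)"
    "successively (\<lambda>x y. {x, y} \<in> E) (u # a # p)"
    using assms unfolding graph_path_def by blast+
  then show ?thesis unfolding graph_path_def by (simp only: last.simps successively.simps) simp
qed

text \<open>
  Paths with the same ends have the same edges by \<open>path_edges_separate\<close>, and only one of these edges
  contains the initial vertex. So the second vertices agree.
\<close>

lemma path_unique:
  assumes "graph_path V E u p v" "graph_path V E u q v"
  shows "p = q"
  using assms
proof (induction p arbitrary: u q)
  case Nil
  then show ?case by (simp add: graph_path_def)
next
  case (Cons x p)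
  have x: "x = u" using Cons.prems(1) by (simp add: graph_path_def)
  have "q \<noteq> []" "hd q = u" using Cons.prems(2) by (simp_all add: graph_path_def)
  then obtain q' where q: "q = u # q'" by (cases q) simp_all
  note path_p = Cons.prems(1)[unfolded x] and path_q = Cons.prems(2)[unfolded q]
  have edges: "path_edges (u # p) = path_edges (u # q')"
    unfolding path_edges_separate[OF path_p] path_edges_separate[OF path_q] ..
  have "p = q'"
  proof (cases "p = []")
    case True
    then have "v = u" using path_p unfolding graph_path_def by simp
    then show ?thesis using True path_singleton[of u q'] path_q by simp
  next
    case False
    then obtain a p' where p: "p = a # p'" by (cases p) simp_all
    have "q' \<noteq> []"
    proof
      assume "q' = []"
      then have "v = u" using path_q by (simp add: graph_path_def)
      then show False using False path_singleton[of u p] path_p by simp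
    qed
    then obtain b r where r: "q' = b # r" by (cases q') simp_all
    have "{u, a} \<in> path_edges (u # p)"
      unfolding path_edges_def p by (rule CollectI, rule exI[of _ 0]) simp
    then have "{u, a} \<in> path_edges (u # q')" unfolding edges .
    then obtain i where "Suc i < length (u # q')" "{u, a} = {(u # q') ! i, (u # q') ! Suc i}"
      unfolding path_edges_def by blast
    then have i: "i < length q'" "{u, a} = {(u # q') ! i, q' ! i}" by simp_all
    have notin: "u \<notin> set q'" using path_q by (simp add: graph_path_def)
    have "i = 0"
    proof (rule ccontr)
      assume "i \<noteq> 0"
      then obtain j where j: "i = Suc j" by (cases i) simp_all
      have "u \<in> {u, a}" by simp
      also have "\<dots> = {q' ! j, q' ! Suc j}" using i(2) j by simp
      finally have "u = q' ! j \<or> u = q' ! Suc j" by blast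
      then have "u \<in> set q'" using i(1) j nth_mem[of j q'] nth_mem[of "Suc j" q'] by (elim disjE) simp_all
      then show False using notin by blast
    qed
    then have "{u, a} = {u, b}" using i(2) r by simp
    then have "a = b" by (auto simp: doubleton_eq_iff)
    then have "graph_path V E a p v" "graph_path V E a q' v"
      using path_tail[of u a p' v] path_tail[of u b r v] path_p path_q p r by simp_all
    then show ?thesis by (rule Cons.IH)
  qed
  then show ?case by (simp only: q x)
qed

lemma tree_path_edges_eq:
  assumes "u \<in> V" "v \<in> V"
  shows "tree_path_edges V E u v = {e \<in> E. (u, v) \<notin> reach (E - {e})}"
proof -
  obtain p where p: "graph_path V E u p v" using tree assms unfolding graph_tree_def by blast
  then have "(THE p. graph_path V E u p v) = p" by (rule the_equality) (rule path_unique[OF _ p])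
  then show ?thesis using path_edges_separate[OF p] by (simp add: tree_path_edges_def)
qed

lemma edge_partition_eq:
  assumes e: "e \<in> E" and r: "r \<in> V" and M: "M \<subseteq> V"
  shows "edge_partition V E M e =
    {{x \<in> M. (r, x) \<notin> reach (E - {e})}, M - {x \<in> M. (r, x) \<notin> reach (E - {e})}}"
proof -
  obtain a b where ab: "e = {a, b}" using edge_doubleton[OF e] by blast
  have aV: "a \<in> V" "b \<in> V" using edge_ends ab e by auto
  define C where "C u = {v \<in> V. (u, v) \<in> reach (E - {e})}" for u
  have C: "graph_components V (E - {e}) = {C u | u. u \<in> V}"
  proof -
    have iff: "(\<exists>p. graph_path V (E - {e}) u p v) \<longleftrightarrow> (u, v) \<in> reach (E - {e})" if "v \<in> V" for u v
      using edge_subset that by (intro graph_path_iff_reach) auto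
    have "{v \<in> V. \<exists>p. graph_path V (E - {e}) u p v} = C u" for u
      unfolding C_def using iff by blast
    then show ?thesis by (simp add: graph_components_def)
  qed
  have "(a, b) \<notin> reach (E - {e})" using bridge[of a b] e by (simp add: ab)
  then have other: "\<exists>s\<in>V. (r, s) \<notin> reach (E - {e})"
    using aV reach_sym[of r a "E - {e}"] reach_trans[of a r "E - {e}" b] by blast
  note sep = separated_iff_root[OF e r]
  have near: "C u \<inter> M = M - {x \<in> M. (r, x) \<notin> reach (E - {e})}" if "u \<in> V" "(r, u) \<in> reach (E - {e})" for u
    unfolding C_def using that M sep[of u] by blast
  have far: "C u \<inter> M = {x \<in> M. (r, x) \<notin> reach (E - {e})}" if "u \<in> V" "(r, u) \<notin> reach (E - {e})" for u
    unfolding C_def using that M sep[of u] by blast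
  obtain s where s: "s \<in> V" "(r, s) \<notin> reach (E - {e})" using other by blast
  have "edge_partition V E M e = (\<lambda>u. C u \<inter> M) ` V"
    unfolding edge_partition_def C by auto
  also have "\<dots> = {C s \<inter> M, C r \<inter> M}"
  proof (intro equalityI subsetI)
    fix X assume "X \<in> (\<lambda>u. C u \<inter> M) ` V"
    then obtain u where u: "u \<in> V" "X = C u \<inter> M" by blast
    show "X \<in> {C s \<inter> M, C r \<inter> M}"
      using near[OF u(1)] far[OF u(1)] near[OF r reach_refl] far[OF s] u(2)
      by (cases "(r, u) \<in> reach (E - {e})") simp_all
  qed (use r s in auto)
  finally show ?thesis unfolding near[OF r reach_refl] far[OF s] .
qed

text \<open>
  The vertices on the side of \<open>w\<close> of the edge from \<open>v\<close> to \<open>w\<close>.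
\<close>

definition branch :: "'a \<Rightarrow> 'a \<Rightarrow> 'a set" where
  "branch v w = {x. (w, x) \<in> reach (E - {{v, w}})}"

lemma branch_subset: "{v, w} \<in> E \<Longrightarrow> branch v w \<subseteq> V"
proof
  fix x assume e: "{v, w} \<in> E" and "x \<in> branch v w"
  then have "(w, x) \<in> reach E" unfolding branch_def using reach_mono[of "E - {{v, w}}" E w x] by auto
  then show "x \<in> V" unfolding reach_def
    by (induction rule: rtrancl_induct) (use e edge_ends in auto)
qed

text \<open>
  Since the edge is a bridge, walks inside the branch never meet the parent \<open>w\<close>. This description no
  longer mentions the edge and makes the branches at \<open>w\<close> easy to compare.
\<close>

lemma branch_avoiding:
  assumes e: "{w, c} \<in> E"
  shows "branch w c = {x. (c, x) \<in> reach {f \<in> E. w \<notin> f}}"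
proof (intro equalityI subsetI; unfold mem_Collect_eq)
  fix x assume "x \<in> branch w c"
  then have "(c, x) \<in> {(x, y). {x, y} \<in> E - {{w, c}}}\<^sup>*" by (simp add: branch_def reach_def)
  then show "(c, x) \<in> reach {f \<in> E. w \<notin> f}"
  proof (induction rule: rtrancl_induct)
    case (step y z)
    have "(c, y) \<in> reach (E - {{w, c}})" "(c, z) \<in> reach (E - {{w, c}})"
      using step(1) rtrancl.rtrancl_into_rtrancl[OF step(1,2)] by (simp_all add: reach_def)
    then have "y \<noteq> w" "z \<noteq> w" using bridge[OF e] reach_sym[of c w] by auto
    then have "(y, z) \<in> reach {f \<in> E. w \<notin> f}" using step(2) by (intro reach_edge) auto
    then show ?case by (rule reach_trans[OF step.IH])
  qed simp
next
  fix x assume "(c, x) \<in> reach {f \<in> E. w \<notin> f}"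
  then show "x \<in> branch w c" unfolding branch_def
    using reach_mono[of "{f \<in> E. w \<notin> f}" "E - {{w, c}}" c x] by auto
qed

lemma branch_not_parent: "{v, w} \<in> E \<Longrightarrow> v \<notin> branch v w"
  using bridge[of v w] reach_sym[of w v] by (auto simp: branch_def)

lemma branch_decomposition:
  assumes e: "{v, w} \<in> E"
  shows "branch v w = insert w (\<Union>c\<in>{c. {w, c} \<in> E \<and> c \<noteq> v}. branch w c)"
proof (intro equalityI subsetI)
  fix x assume "x \<in> branch v w"
  then have "(w, x) \<in> {(x, y). {x, y} \<in> E - {{v, w}}}\<^sup>*" by (simp add: branch_def reach_def)
  then show "x \<in> insert w (\<Union>c\<in>{c. {w, c} \<in> E \<and> c \<noteq> v}. branch w c)"
  proof (induction rule: rtrancl_induct)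
    case (step y z)
    have yz: "{y, z} \<in> E" "{y, z} \<noteq> {v, w}" using step(2) by auto
    show ?case
    proof (cases "y = w")
      case True
      then have "z \<in> branch w z" "z \<noteq> v" using yz by (auto simp: branch_def insert_commute)
      then show ?thesis using yz True by blast
    next
      case False
      then obtain c where c: "{w, c} \<in> E" "c \<noteq> v" "y \<in> branch w c" using step.IH by auto
      show ?thesis
      proof (cases "z = w")
        case False
        then have "(y, z) \<in> reach {f \<in> E. w \<notin> f}" using \<open>y \<noteq> w\<close> yz by (intro reach_edge) auto
        moreover have "(c, y) \<in> reach {f \<in> E. w \<notin> f}" using c(3) branch_avoiding[OF c(1)] by simp
        ultimately have "z \<in> branch w c"
          using reach_trans[of c y _ z] branch_avoiding[OF c(1)] by simp
        then show ?thesis using c by blast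
      qed simp
    qed
  qed simp
next
  fix x assume "x \<in> insert w (\<Union>c\<in>{c. {w, c} \<in> E \<and> c \<noteq> v}. branch w c)"
  then consider "x = w" | c where "{w, c} \<in> E" "c \<noteq> v" "x \<in> branch w c" by auto
  then show "x \<in> branch v w"
  proof cases
    case 1
    then show ?thesis by (simp add: branch_def)
  next
    case 2
    then have "(c, x) \<in> reach {f \<in> E. w \<notin> f}" using branch_avoiding[of w c] by simp
    then have "(c, x) \<in> reach (E - {{v, w}})" by (rule reach_mono[rotated]) auto
    moreover have "(w, c) \<in> reach (E - {{v, w}})"
      using 2 edge_ends[OF 2(1)] by (intro reach_edge) (auto simp: doubleton_eq_iff)
    ultimately show ?thesis using reach_trans[of w c _ x] by (simp add: branch_def)
  qed
qed

lemma branches_disjoint: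
  assumes "{w, c} \<in> E" "{w, d} \<in> E" "c \<noteq> d"
  shows "branch w c \<inter> branch w d = {}"
proof (rule ccontr)
  assume "branch w c \<inter> branch w d \<noteq> {}"
  then obtain x where "(c, x) \<in> reach {f \<in> E. w \<notin> f}" "(d, x) \<in> reach {f \<in> E. w \<notin> f}"
    using branch_avoiding[OF assms(1)] branch_avoiding[OF assms(2)] by blast
  then have "(c, d) \<in> reach {f \<in> E. w \<notin> f}" using reach_sym[of d x] reach_trans[of c x _ d] by simp
  then have "(c, d) \<in> reach (E - {{w, c}})" by (rule reach_mono[rotated]) auto
  moreover have "(d, w) \<in> reach (E - {{w, c}})"
    using assms by (intro reach_edge) (auto simp: doubleton_eq_iff insert_commute)
  ultimately have "(c, w) \<in> reach (E - {{w, c}})" by (rule reach_trans)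
  then show False using bridge[OF assms(1)] reach_sym[of c w] by blast
qed

end

lemma card_3_remove:
  assumes "card S = 3" "x \<in> S"
  shows "\<exists>y z. S = {x, y, z} \<and> y \<noteq> z \<and> x \<noteq> y \<and> x \<noteq> z"
proof -
  have "finite S" using assms by (metis card.infinite zero_neq_numeral)
  then have "card (S - {x}) = 2" using assms by simp
  then obtain y z where yz: "S - {x} = {y, z}" "y \<noteq> z" unfolding card_2_iff by blast
  have "S = insert x (S - {x})" using assms(2) by blast
  moreover have "x \<notin> {y, z}" unfolding yz(1)[symmetric] by simp
  ultimately show ?thesis using yz by auto
qed

text \<open>
  Recursion over the branches pointing away from the root \<open>r\<close>. A vertex of degree \<open>3\<close> has, apart from
  its parent edge, exactly two edges, which become the children. The edge \<open>{v, w}\<close> to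
  the parent corresponds to the subtree itself, so subtrees and edges have the same
  sets of boundary points below them.
\<close>

lemma (in finite_tree) branch_leaf_tree:
  assumes deg: "\<forall>x\<in>V. degree_in E x = 1 \<or> degree_in E x = 3"
    and M: "M = {x \<in> V. degree_in E x = 1}" and rV: "r \<in> V"
    and far: "\<And>e. A e = {x \<in> M. (r, x) \<notin> reach (E - {e})}"
  assumes vw: "{v, w} \<in> E" and r: "r \<notin> branch v w"
  shows "\<exists>T. distinct_leaves T \<and> leaves T = branch v w \<inter> M \<and>
    leaves ` subtrees T = A ` {e \<in> E. e \<inter> branch v w \<noteq> {}}"
  using vw r
proof (induction "card (branch v w)" arbitrary: v w rule: less_induct)
  case less
  note vw = less.prems(1) and r = less.prems(2)
  have wV: "w \<in> V" "v \<noteq> w" using edge_ends[OF vw] by auto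
  have fin: "finite (branch v w)" using finite_subset[OF branch_subset[OF vw] finite_V] .
  have Avw: "A {v, w} = branch v w \<inter> M"
  proof -
    have "(r, x) \<notin> reach (E - {{v, w}}) \<longleftrightarrow> x \<in> branch v w" if "x \<in> M" for x
    proof -
      have "{w, v} = {v, w}" by auto
      then show ?thesis
        using separated_iff[of w v r x] vw rV r that M by (auto simp: branch_def)
    qed
    then show ?thesis unfolding far by blast
  qed
  have wb: "w \<in> branch v w" by (simp add: branch_def)
  define N where "N = {e \<in> E. w \<in> e}"
  have vwN: "{v, w} \<in> N" using vw by (simp add: N_def)
  have cardN: "card N = degree_in E w" by (simp add: N_def degree_in_def)
  consider "degree_in E w = 1" | "degree_in E w = 3" using deg wV by blast
  then show ?case
  proof cases
    case 1
    then have "N = {{v, w}}" using cardN vwN by (auto simp: card_1_singleton_iff)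
    then have N1: "e = {v, w}" if "e \<in> E" "w \<in> e" for e using that by (auto simp: N_def)
    have nochild: "{c. {w, c} \<in> E \<and> c \<noteq> v} = {}"
    proof (rule ccontr)
      assume "\<not> ?thesis"
      then obtain c where "{w, c} \<in> E" "c \<noteq> v" by blast
      then show False using N1[of "{w, c}"] by (auto simp: doubleton_eq_iff)
    qed
    have bw: "branch v w = {w}" using branch_decomposition[OF vw] nochild by simp
    have wM: "w \<in> M" using 1 wV M by simp
    have "{e \<in> E. e \<inter> {w} \<noteq> {}} = {{v, w}}" using N1 vw by blast
    then show ?thesis using Avw wM unfolding bw by (intro exI[of _ "Leaf w"]) simp
  next
    case 2
    have wM: "w \<notin> M" using 2 M by simp
    obtain e1 e2 where N3: "N = {{v, w}, e1, e2}" "e1 \<noteq> e2" "{v, w} \<noteq> e1" "{v, w} \<noteq> e2"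
      using card_3_remove[of N "{v, w}"] cardN 2 vwN by auto
    have child: "\<exists>c. e = {w, c} \<and> {w, c} \<in> E \<and> c \<noteq> v" if "e \<in> N" "{v, w} \<noteq> e" for e
    proof -
      have e: "e \<in> E" "w \<in> e" using that(1) by (simp_all add: N_def)
      then obtain a b where "e = {a, b}" using edge_doubleton by blast
      then obtain c where "e = {w, c}" using e(2) by blast
      then show ?thesis using e(1) that(2) by blast
    qed
    obtain c d where c: "e1 = {w, c}" "{w, c} \<in> E" "c \<noteq> v" and d: "e2 = {w, d}" "{w, d} \<in> E" "d \<noteq> v"
      using child[of e1] child[of e2] N3 by blast
    have cd: "c \<noteq> d" using N3(2) c d by auto
    have children: "{c. {w, c} \<in> E \<and> c \<noteq> v} = {c, d}"
    proof (intro equalityI subsetI)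
      fix x assume "x \<in> {c. {w, c} \<in> E \<and> c \<noteq> v}"
      then have x: "{w, x} \<in> N" "x \<noteq> v" by (simp_all add: N_def)
      then have "{w, x} = {v, w} \<or> {w, x} = {w, c} \<or> {w, x} = {w, d}"
        unfolding N3(1) c(1) d(1) by blast
      with x(2) show "x \<in> {c, d}" by (auto simp: doubleton_eq_iff)
    qed (use c d in auto)
    have dec: "branch v w = insert w (branch w c \<union> branch w d)"
      using branch_decomposition[OF vw] children by simp
    have disj: "branch w c \<inter> branch w d = {}" by (rule branches_disjoint[OF c(2) d(2) cd])
    have wn: "w \<notin> branch w c" "w \<notin> branch w d"
      by (rule branch_not_parent[OF c(2)], rule branch_not_parent[OF d(2)])
    have cards: "card (branch w c) < card (branch v w)" "card (branch w d) < card (branch v w)"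
      using dec wn by (blast intro: psubset_card_mono[OF fin])+
    have rn: "r \<notin> branch w c" "r \<notin> branch w d" using r dec by blast+
    obtain S where S: "distinct_leaves S" "leaves S = branch w c \<inter> M"
        "leaves ` subtrees S = A ` {e \<in> E. e \<inter> branch w c \<noteq> {}}"
      using less.hyps[OF cards(1) c(2) rn(1)] by (elim exE conjE)
    obtain T where T: "distinct_leaves T" "leaves T = branch w d \<inter> M"
        "leaves ` subtrees T = A ` {e \<in> E. e \<inter> branch w d \<noteq> {}}"
      using less.hyps[OF cards(2) d(2) rn(2)] by (elim exE conjE)
    have leaves: "leaves (Node S T) = branch v w \<inter> M" 
      unfolding leaves.simps S(2) T(2) dec using wM by blast
    have edges: "{e \<in> E. e \<inter> branch v w \<noteq> {}}
        = insert {v, w} ({e \<in> E. e \<inter> branch w c \<noteq> {}} \<union> {e \<in> E. e \<inter> branch w d \<noteq> {}})"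
    proof -
      have "e = {v, w} \<or> e = {w, c} \<or> e = {w, d}" if "e \<in> E" "w \<in> e" for e
      proof -
        have "e \<in> N" using that by (simp add: N_def)
        then show ?thesis unfolding N3(1) c(1) d(1) by blast
      qed
      moreover have "c \<in> branch w c" "d \<in> branch w d" by (simp_all add: branch_def)
      ultimately show ?thesis unfolding dec using vw by blast
    qed
    have "leaves ` subtrees (Node S T) = A ` {e \<in> E. e \<inter> branch v w \<noteq> {}}"
      unfolding edges using S(3) T(3) leaves Avw by (simp add: image_Un)
    moreover have "distinct_leaves (Node S T)" using S T disj by auto
    ultimately show ?thesis using leaves by (intro exI[of _ "Node S T"] conjI)
  qed
qed

text \<open>
  All that is used later of the graph: \<open>A e\<close> is the set of boundary points on the side of \<open>e\<close> away
  from \<open>r\<close>, and these sets are the leaf sets of the subtrees of a rooted tree.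
\<close>

lemma binary_tree_leaf_tree:
  assumes bt: "binary_tree V E" and con: "connects V E M" and r: "r \<in> M"
  obtains T A where "distinct_leaves T" "leaves T = M - {r}" "leaves ` subtrees T = A ` E"
    and "\<And>e. e \<in> E \<Longrightarrow> edge_partition V E M e = {A e, M - A e}"
    and "\<And>u v. u \<in> M \<Longrightarrow> v \<in> M \<Longrightarrow> tree_path_edges V E u v = {e \<in> E. (u \<in> A e) \<noteq> (v \<in> A e)}"
proof -
  interpret finite_tree V E using bt by unfold_locales (simp add: binary_tree_def)
  define A where "A e = {x \<in> M. (r, x) \<notin> reach (E - {e})}" for e
  have M: "M = {x \<in> V. degree_in E x = 1}" using con by (auto simp: connects_def tree_boundary_def)
  have deg: "\<forall>x\<in>V. degree_in E x = 1 \<or> degree_in E x = 3" using bt by (simp add: binary_tree_def)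
  have MV: "M \<subseteq> V" using M by auto
  have rV: "r \<in> V" using r M by simp
  have "card {e \<in> E. r \<in> e} = 1" using r M by (simp add: degree_in_def)
  then obtain e0 where e0: "{e \<in> E. r \<in> e} = {e0}" by (auto simp: card_1_singleton_iff)
  then have e0E: "e0 \<in> E" "r \<in> e0" by auto
  then obtain s where s: "e0 = {r, s}" using edge_doubleton[OF e0E(1)] by fastforce
  have rs: "{r, s} \<in> E" using s e0E by simp
  have only: "e = {r, s}" if "e \<in> E" "r \<in> e" for e using e0 that s by auto
  have rb: "r \<notin> branch r s" by (rule branch_not_parent[OF rs])
  have "branch s r = {r}"
  proof -
    have nochild: "{c. {r, c} \<in> E \<and> c \<noteq> s} = {}"
    proof (rule ccontr)
      assume "\<not> ?thesis"
      then obtain c where "{r, c} \<in> E" "c \<noteq> s" by blast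
      then show False using only[of "{r, c}"] by (auto simp: doubleton_eq_iff)
    qed
    have sr: "{s, r} \<in> E" using rs unfolding insert_commute[of s r] .
    show ?thesis unfolding branch_decomposition[OF sr] nochild by simp
  qed
  then have br: "branch r s = V - {r}"
  proof (intro equalityI subsetI)
    fix x assume x: "x \<in> V - {r}"
    then have "x \<notin> branch s r" using \<open>branch s r = {r}\<close> by simp
    then show "x \<in> branch r s" 
      using two_sides[OF rs, of x] x unfolding branch_def insert_commute[of s r] by blast
  qed (use branch_subset[OF rs] rb in blast)
  obtain T where T: "distinct_leaves T" "leaves T = branch r s \<inter> M"
    "leaves ` subtrees T = A ` {e \<in> E. e \<inter> branch r s \<noteq> {}}"
    using branch_leaf_tree[OF deg M rV A_def rs rb] by (elim exE conjE)
  have "e \<inter> branch r s \<noteq> {}" if "e \<in> E" for e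
    using edge_doubleton[OF that] edge_subset[OF that] unfolding br by blast
  then have "{e \<in> E. e \<inter> branch r s \<noteq> {}} = E" by auto
  moreover have "leaves T = M - {r}" using T(2) br MV by auto
  moreover have "tree_path_edges V E u v = {e \<in> E. (u \<in> A e) \<noteq> (v \<in> A e)}" if uv: "u \<in> M" "v \<in> M" for u v
  proof -
    have "(u, v) \<in> reach (E - {e}) \<longleftrightarrow> (u \<in> A e \<longleftrightarrow> v \<in> A e)" if e: "e \<in> E" for e
      using separated_iff_root[OF e rV, of u v] uv MV unfolding A_def by blast
    then show ?thesis using tree_path_edges_eq uv MV by auto
  qed
  moreover have "edge_partition V E M e = {A e, M - A e}" if "e \<in> E" for e
    using edge_partition_eq[OF that rV MV] by (simp add: A_def)
  ultimately show thesis using T by (intro that[of T A]) auto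
qed

section \<open>Closed Euler walks as cyclic sequences\<close>

text \<open>
  The third component of an arc numbers the \<open>a u v\<close> parallel arcs from \<open>u\<close> to \<open>v\<close>.
\<close>

definition multi_arcs :: "'a set \<Rightarrow> ('a \<Rightarrow> 'a \<Rightarrow> nat) \<Rightarrow> ('a, 'a \<times> 'a \<times> nat) pre_digraph" where
  "multi_arcs M a = \<lparr>verts = M, arcs = (SIGMA u:M. SIGMA v:M. {..<a u v}),
     tail = fst, head = \<lambda>e. fst (snd e)\<rparr>"

lemma multi_arcs_simps [simp]:
  "verts (multi_arcs M a) = M" "tail (multi_arcs M a) = fst" "head (multi_arcs M a) = (\<lambda>e. fst (snd e))"
  "arcs (multi_arcs M a) = (SIGMA u:M. SIGMA v:M. {..<a u v})"
  by (simp_all add: multi_arcs_def)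

lemma fin_digraph_multi_arcs: "finite M \<Longrightarrow> fin_digraph (multi_arcs M a)"
  by unfold_locales auto

lemma out_degree_multi_arcs:
  assumes "finite M" "u \<in> M"
  shows "out_degree (multi_arcs M a) u = (\<Sum>v\<in>M. a u v)"
proof -
  have "out_arcs (multi_arcs M a) u = Pair u ` (SIGMA v:M. {..<a u v})"
    using assms(2) by (auto simp: out_arcs_def)
  then have "out_degree (multi_arcs M a) u = card (Pair u ` (SIGMA v:M. {..<a u v}))"
    by (simp only: out_degree_def)
  also have "\<dots> = card (SIGMA v:M. {..<a u v})" by (rule card_image) (simp add: inj_on_def)
  finally show ?thesis using assms(1) by simp
qed

lemma in_degree_multi_arcs:
  assumes "finite M" "u \<in> M"
  shows "in_degree (multi_arcs M a) u = (\<Sum>v\<in>M. a v u)"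
proof -
  have "in_arcs (multi_arcs M a) u = (\<lambda>(v, i). (v, u, i)) ` (SIGMA v:M. {..<a v u})"
    using assms(2) by (auto simp: in_arcs_def image_iff)
  then have "in_degree (multi_arcs M a) u = card ((\<lambda>(v, i). (v, u, i)) ` (SIGMA v:M. {..<a v u}))"
    by (simp only: in_degree_def)
  also have "\<dots> = card (SIGMA v:M. {..<a v u})" by (rule card_image) (auto simp: inj_on_def)
  finally show ?thesis using assms(1) by simp
qed

lemma connected_multi_arcs:
  assumes "finite M" "M \<noteq> {}"
    and conn: "\<And>u v. u \<in> M \<Longrightarrow> v \<in> M \<Longrightarrow> (u, v) \<in> {(u, v). u \<in> M \<and> v \<in> M \<and> a u v \<noteq> 0}\<^sup>*"
  shows "Digraph_Component.connected (multi_arcs M a)"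
proof -
  interpret fin_digraph "multi_arcs M a" using fin_digraph_multi_arcs[OF assms(1)] .
  have "u \<rightarrow>\<^sup>*\<^bsub>multi_arcs M a\<^esub> v" if "u \<in> M" "v \<in> M" for u v
    using conn[OF that]
  proof (induction rule: rtrancl_induct)
    case base
    then show ?case using that by simp
  next
    case (step y z)
    then have "(y, z, 0) \<in> arcs (multi_arcs M a)" by simp
    then have "(y, z) \<in> arcs_ends (multi_arcs M a)"
      unfolding arcs_ends_def arc_to_ends_def by (rule rev_image_eqI) simp
    then show ?case using step.IH by (rule reachable_adj_trans[rotated])
  qed
  then have "u \<rightarrow>\<^sup>*\<^bsub>mk_symmetric (multi_arcs M a)\<^esub> v" if "u \<in> M" "v \<in> M" for u v
    using that by (intro reachable_mk_symmetricI)
  then show ?thesis using assms(2) unfolding Digraph_Component.connected_def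
    by (intro strongly_connectedI) simp_all
qed

lemma (in pre_digraph) cas_nth:
  "cas u p v \<Longrightarrow> Suc i < length p \<Longrightarrow> tail G (p ! Suc i) = head G (p ! i)"
proof (induction p arbitrary: u i)
  case (Cons e p)
  then show ?case by (cases i; cases p) auto
qed simp

lemma (in pre_digraph) cas_first: "cas u p v \<Longrightarrow> p \<noteq> [] \<Longrightarrow> tail G (p ! 0) = u"
  by (cases p) auto

lemma (in pre_digraph) cas_last: "cas u p v \<Longrightarrow> p \<noteq> [] \<Longrightarrow> head G (p ! (length p - 1)) = v"
proof (induction p arbitrary: u)
  case (Cons e p)
  then show ?case by (cases p) auto
qed simp

text \<open>
  Listing the tails of the arcs of a closed Euler walk gives the sequence, since the head of every arc
  is the tail of the cyclically next one. The identity for arbitrary \<open>f\<close> says that every step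
  from \<open>u\<close> to \<open>v\<close> is made \<open>a u v\<close> times. All counts and the perimeter are instances.
\<close>

lemma euler_cyclic_sequence:
  fixes a :: "'a \<Rightarrow> 'a \<Rightarrow> nat"
  assumes M: "finite M" "M \<noteq> {}"
    and balanced: "\<And>u. u \<in> M \<Longrightarrow> (\<Sum>v\<in>M. a v u) = (\<Sum>v\<in>M. a u v)"
    and conn: "\<And>u v. u \<in> M \<Longrightarrow> v \<in> M \<Longrightarrow> (u, v) \<in> {(u, v). u \<in> M \<and> v \<in> M \<and> a u v \<noteq> 0}\<^sup>*"
    and N: "N = (\<Sum>u\<in>M. \<Sum>v\<in>M. a u v)"
  obtains \<pi> :: "nat \<Rightarrow> 'a" where "\<pi> \<in> {..<N} \<rightarrow> M"
    and "\<And>f :: 'a \<Rightarrow> 'a \<Rightarrow> real.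
      (\<Sum>j<N. f (\<pi> j) (\<pi> (Suc j mod N))) = (\<Sum>u\<in>M. \<Sum>v\<in>M. real (a u v) * f u v)"
proof -
  let ?G = "multi_arcs M a"
  interpret fin_digraph ?G using fin_digraph_multi_arcs[OF M(1)] .
  have "\<exists>u p. euler_trail u p u"
    using connected_multi_arcs[OF M conn]
    by (rule closed_euler1) (simp_all add: in_degree_multi_arcs out_degree_multi_arcs M(1) balanced)
  then obtain u p where "euler_trail u p u" by blast
  then have cas: "cas u p u" and p: "distinct p" "set p = arcs ?G"
    unfolding euler_trail_def trail_def awalk_def by simp_all
  have len: "length p = N"
  proof -
    have "length p = card (arcs ?G)" using distinct_card[OF p(1)] p(2) by simp
    then show ?thesis using M(1) by (simp add: N)
  qed
  define \<pi> where "\<pi> j = fst (p ! j)" for j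
  have succ: "\<pi> (Suc j mod N) = fst (snd (p ! j))" if j: "j < N" for j
  proof (cases "Suc j = N")
    case True
    have "p \<noteq> []" using j len by auto
    moreover have "length p - 1 = j" "Suc j mod N = 0" using True len by simp_all
    ultimately show ?thesis
      using cas_first[OF cas] cas_last[OF cas] by (simp add: \<pi>_def)
  next
    case False
    then have "Suc j < N" using j by simp
    then show ?thesis using cas_nth[OF cas, of j] len by (simp add: \<pi>_def)
  qed
  have arc: "p ! j \<in> arcs ?G" if "j < N" for j
    using that nth_mem[of j p] p(2) len by simp
  show thesis
  proof (rule that[of \<pi>])
    show "\<pi> \<in> {..<N} \<rightarrow> M"
    proof (rule Pi_I)
      fix j assume "j \<in> {..<N}"
      then show "\<pi> j \<in> M" using tail_in_verts[OF arc[of j]] by (simp add: \<pi>_def)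
    qed
    fix f :: "'a \<Rightarrow> 'a \<Rightarrow> real"
    have "(\<Sum>j<N. f (\<pi> j) (\<pi> (Suc j mod N))) = (\<Sum>j<N. f (fst (p ! j)) (fst (snd (p ! j))))"
      by (intro sum.cong refl) (simp add: succ \<pi>_def[symmetric])
    also have "\<dots> = (\<Sum>e\<in>arcs ?G. f (fst e) (fst (snd e)))"
    proof (rule sum.reindex_bij_betw)
      show "bij_betw ((!) p) {..<N} (arcs ?G)"
        by (rule bij_betw_nth[OF p(1)]) (simp_all only: len p(2))
    qed
    also have "\<dots> = (\<Sum>u\<in>M. \<Sum>v\<in>M. \<Sum>i<a u v. f u v)"
      using M(1) by (simp add: sum.Sigma split_beta' del: sum_constant)
    finally show "(\<Sum>j<N. f (\<pi> j) (\<pi> (Suc j mod N))) = (\<Sum>u\<in>M. \<Sum>v\<in>M. real (a u v) * f u v)"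
      by simp
  qed
qed

section \<open>Multi-tours from optimal weights\<close>

lemma joins_singleton: "p \<in> pairs M \<Longrightarrow> u \<in> M \<Longrightarrow> joins {u} (M - {u}) p \<longleftrightarrow> u \<in> p"
  by (auto simp: joins_def elim!: pairsE)

lemma sum_pairs_at:
  assumes "finite M" "u \<in> M"
  shows "(\<Sum>p\<in>pairs M. x p * of_bool (u \<in> p)) = cross x {u} (M - {u})"
proof -
  have "(\<Sum>p\<in>pairs M. x p * of_bool (u \<in> p)) = (\<Sum>p\<in>pairs M. x p * of_bool (joins {u} (M - {u}) p))"
    using assms(2) by (intro sum.cong refl) (simp add: joins_singleton)
  then show ?thesis using sum_joining_pairs[of M "{u}" "M - {u}" x] assms by simp
qed

text \<open>
  Apply \<open>grouped_system_denominator\<close> with the points other than \<open>r\<close> as equations, and group the pairs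
  without \<open>r\<close> by their lowest common ancestors.
\<close>

lemma tree_denominator:
  assumes T: "distinct_leaves T" "r \<notin> leaves T" "M = insert r (leaves T)" and n: "3 \<le> card M"
    and zero: "\<And>p. p \<notin> pairs M \<Longrightarrow> x p = 0"
    and eq: "\<And>t. t \<in> subtrees T \<Longrightarrow> cross x (leaves t) (M - leaves t) = 1"
    and ind: "\<And>z. (\<forall>p. x p = 0 \<longrightarrow> z p = 0) \<Longrightarrow>
      (\<forall>t\<in>subtrees T. cross z (leaves t) (M - leaves t) = 0) \<Longrightarrow> (\<forall>p. z p = 0)"
  shows "\<exists>K::nat. 0 < K \<and> K \<le> 2 ^ (2 * card M - 5) \<and> (\<forall>p. real K * x p \<in> \<int>)"
proof -
  have M: "finite M" "leaves T \<subseteq> M" using T(3) by auto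
  have cardM: "card M = Suc (card (leaves T))" using T(2,3) by simp
  define S where "S = {p. x p \<noteq> 0}"
  define Sr where "Sr = {p \<in> S. r \<in> p}"
  have SP: "S \<subseteq> pairs M" using zero by (auto simp: S_def)
  have finS: "finite S" using finite_subset[OF SP finite_pairs[OF M(1)]] .
  have p2: "card p = 2" "p \<subseteq> M" "finite p" if "p \<in> S" for p
  proof -
    show "card p = 2" "p \<subseteq> M" using that SP by (auto simp: pairs_def)
    then show "finite p" using M(1) finite_subset by blast
  qed
  have inner: "p \<in> pairs (leaves T)" if "p \<in> S - Sr" for p
    using that p2[of p] T(3) by (auto simp: pairs_def Sr_def)
  have leaf_sum: "(\<Sum>p\<in>S. z p * of_bool (u \<in> p - {r})) = cross z {u} (M - {u})"
    if z: "\<forall>p. x p = 0 \<longrightarrow> z p = 0" and u: "u \<in> leaves T" for z u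
  proof -
    have "(\<Sum>p\<in>S. z p * of_bool (u \<in> p - {r})) = (\<Sum>p\<in>pairs M. z p * of_bool (u \<in> p))"
      using finite_pairs[OF M(1)] SP z u T(2)
      by (intro sum.mono_neutral_cong_left) (auto simp: S_def)
    then show ?thesis using sum_pairs_at[OF M(1), of u z] u M(2) by auto
  qed
  have node_sum: "(\<Sum>p\<in>{p \<in> S - Sr. lca T p = Node a b}. z p) = cross z (leaves a) (leaves b)"
    if z: "\<forall>p. x p = 0 \<longrightarrow> z p = 0" and ab: "Node a b \<in> subtrees T" for z a b
  proof -
    have sub: "leaves a \<subseteq> leaves T" "leaves b \<subseteq> leaves T" using leaves_subtree[OF ab] by auto
    have disj: "leaves a \<inter> leaves b = {}" using distinct_leaves_subtree[OF ab T(1)] by simp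
    have no_root: "\<not> joins (leaves a) (leaves b) p" if p: "p \<in> pairs M" "r \<in> p" for p
    proof -
      obtain u where "p = {u, r}" using p by (auto elim!: pairsE simp: insert_commute)
      then show ?thesis using sub disj T(2) unfolding joins_def by blast
    qed
    have same: "p \<in> S - Sr \<and> lca T p = Node a b \<longleftrightarrow> p \<in> S \<and> joins (leaves a) (leaves b) p" for p
    proof (cases "p \<in> S - Sr")
      case True
      then show ?thesis using lca_eq_iff[OF T(1) inner[OF True] ab] by simp
    next
      case False
      then show ?thesis using no_root[of p] SP by (auto simp: Sr_def)
    qed
    have "(\<Sum>p\<in>{p \<in> S - Sr. lca T p = Node a b}. z p) = (\<Sum>p\<in>pairs M. z p * of_bool (joins (leaves a) (leaves b) p))"
      unfolding same using finite_pairs[OF M(1)] SP z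
      by (intro sum.mono_neutral_cong_left) (auto simp: S_def)
    also have "\<dots> = cross z (leaves a) (leaves b)"
      using sub M disj by (intro sum_joining_pairs) auto
    finally show ?thesis .
  qed
  have node: "\<exists>a b. w = Node a b \<and> Node a b \<in> subtrees T" if "w \<in> lca T ` (S - Sr)" for w
    using that lca_Node[OF T(1) inner] by blast
  have half: "cross x (leaves a) (leaves b) = 1 / 2" if "Node a b \<in> subtrees T" for a b
    using node_equation[OF M(1) T(1) M(2) eq that] .
  have "\<exists>K::nat. 0 < K \<and> K \<le> 2 * 4 ^ (card (leaves T) - 2) \<and> (\<forall>p\<in>S. real K * x p \<in> \<int>)"
  proof (rule grouped_system_denominator[where Sr = Sr and inc = "\<lambda>p. p - {r}" and g = "lca T"])
    show "finite S" "finite (leaves T)" "Sr \<subseteq> S" using finS by (auto simp: Sr_def)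
    show "p - {r} \<subseteq> leaves T" if "p \<in> S" for p using p2[OF that] T(3) by auto
    show "card (p - {r}) = 1" if "p \<in> Sr" for p using that p2[of p] by (simp add: Sr_def)
    show "card (p - {r}) = 2" if "p \<in> S - Sr" for p using that p2[of p] by (simp add: Sr_def)
    show "(\<Sum>p\<in>S. x p * of_bool (u \<in> p - {r})) = 1" if "u \<in> leaves T" for u
      using leaf_sum[of x u] that eq[of "Leaf u"] by (simp add: leaf_subtree_iff)
    show "(\<Sum>p\<in>{p \<in> S - Sr. lca T p = w}. x p) = 1 / 2" if "w \<in> lca T ` (S - Sr)" for w
      using node[OF that] node_sum[of x] half by auto
    show "\<forall>p\<in>S. z p = 0"
      if z1: "\<forall>u\<in>leaves T. (\<Sum>p\<in>S. z p * of_bool (u \<in> p - {r})) = 0"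
        and z2: "\<forall>w\<in>lca T ` (S - Sr). (\<Sum>p\<in>{p \<in> S - Sr. lca T p = w}. z p) = 0" for z :: "'a set \<Rightarrow> real"
    proof -
      define z' where "z' p = (if p \<in> S then z p else 0)" for p
      have z': "\<forall>p. x p = 0 \<longrightarrow> z' p = 0" by (simp add: z'_def S_def)
      have leaf: "cross z' {u} (M - {u}) = 0" if "u \<in> leaves T" for u
      proof -
        have "(\<Sum>p\<in>S. z' p * of_bool (u \<in> p - {r})) = (\<Sum>p\<in>S. z p * of_bool (u \<in> p - {r}))"
          by (intro sum.cong refl) (simp add: z'_def)
        then show ?thesis using leaf_sum[OF z' that] z1 that by simp
      qed
      have nd: "cross z' (leaves a) (leaves b) = 0 / 2" if "Node a b \<in> subtrees T" for a b
      proof -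
        have "(\<Sum>p\<in>{p \<in> S - Sr. lca T p = Node a b}. z' p) = (\<Sum>p\<in>{p \<in> S - Sr. lca T p = Node a b}. z p)"
          by (intro sum.cong refl) (simp add: z'_def)
        also have "\<dots> = 0"
        proof (cases "Node a b \<in> lca T ` (S - Sr)")
          case True
          then show ?thesis using z2 by blast
        next
          case False
          then have "lca T p \<noteq> Node a b" if "p \<in> S - Sr" for p
            using imageI[OF that, of "lca T"] by auto
          then have "{p \<in> S - Sr. lca T p = Node a b} = {}" by blast
          then show ?thesis by (simp only: sum.empty)
        qed
        finally show ?thesis using node_sum[OF z' that] by simp
      qed
      have "\<forall>p. z' p = 0"
        using cut_equations[OF M(1) T(1) M(2) leaf nd] by (intro ind[OF z']) blast
      then show ?thesis by (auto simp: z'_def split: if_splits)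
    qed
    show "2 \<le> card Sr"
    proof -
      obtain a b where ab: "T = Node a b" using n cardM by (cases T) auto
      have disj: "leaves a \<inter> leaves b = {}" and rn: "r \<notin> leaves a" "r \<notin> leaves b" using T ab by auto
      \<comment> \<open>the branch \<open>c\<close> exchanges \<open>1 / 2\<close> with its sibling \<open>d\<close>, and the other half with \<open>r\<close>\<close>
      have end_pair: "\<exists>u\<in>leaves c. {u, r} \<in> Sr"
        if c: "c = a \<and> d = b \<or> c = b \<and> d = a" for c d
      proof -
        have cd: "c \<in> subtrees T" "leaves c \<inter> leaves d = {}" "r \<notin> leaves c" "r \<notin> leaves d"
          using c ab disj rn by auto
        have "M - leaves c = leaves d \<union> {r}" using c ab T(3) disj rn by auto
        then have "1 = cross x (leaves c) (leaves d) + cross x (leaves c) {r}"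
          using eq[OF cd(1)] cross_Un_right[of "leaves d" "{r}" x "leaves c"] cd(4) by simp
        moreover have "cross x (leaves c) (leaves d) = 1 / 2"
          using c half[of a b] ab cross_commute[of x "leaves b" "leaves a"] by auto
        ultimately have "(\<Sum>u\<in>leaves c. x {u, r}) \<noteq> 0" by (simp add: cross_def)
        then obtain u where "u \<in> leaves c" "x {u, r} \<noteq> 0"
          using sum.not_neutral_contains_not_neutral by blast
        then show ?thesis by (auto simp: Sr_def S_def)
      qed
      obtain u v where uv: "u \<in> leaves a" "{u, r} \<in> Sr" "v \<in> leaves b" "{v, r} \<in> Sr"
        using end_pair[of a b] end_pair[of b a] by blast
      have "{u, r} \<noteq> {v, r}" using uv disj rn by (auto simp: doubleton_eq_iff)
      then have "card {{u, r}, {v, r}} = 2" by simp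
      moreover have "card {{u, r}, {v, r}} \<le> card Sr"
        using uv finS by (intro card_mono) (auto simp: Sr_def)
      ultimately show ?thesis by simp
    qed
  qed
  then obtain K :: nat where K: "0 < K" "K \<le> 2 * 4 ^ (card (leaves T) - 2)" "\<forall>p\<in>S. real K * x p \<in> \<int>"
    by blast
  have "2 * 4 ^ (card (leaves T) - 2) = (2::nat) ^ (2 * card M - 5)"
  proof -
    have "2 * card M - 5 = Suc (2 * (card (leaves T) - 2))" using n cardM by simp
    then show ?thesis by (simp add: power_mult)
  qed
  moreover have "real K * x p \<in> \<int>" for p using K(3) by (cases "p \<in> S") (auto simp: S_def)
  ultimately show ?thesis using K by auto
qed

lemma sum_ordered_pairs:
  assumes "finite M" and zero: "\<And>p. p \<notin> pairs M \<Longrightarrow> h p = (0::real)"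
  shows "(\<Sum>u\<in>M. \<Sum>v\<in>M. h {u, v}) = 2 * (\<Sum>p\<in>pairs M. h p)"
proof -
  have "(\<Sum>v\<in>M. h {u, v}) = (\<Sum>p\<in>pairs M. h p * of_bool (u \<in> p))" if u: "u \<in> M" for u
  proof -
    have "{u, u} \<notin> pairs M" by (simp add: pairs_def)
    then have "(\<Sum>v\<in>M. h {u, v}) = cross h {u} (M - {u})"
      using assms(1) u zero[of "{u}"] by (simp add: cross_def sum.remove[of M u])
    then show ?thesis using sum_pairs_at[OF assms(1) u] by simp
  qed
  then have "(\<Sum>u\<in>M. \<Sum>v\<in>M. h {u, v}) = (\<Sum>u\<in>M. \<Sum>p\<in>pairs M. h p * of_bool (u \<in> p))"
    by (intro sum.cong refl) simp
  also have "\<dots> = (\<Sum>p\<in>pairs M. h p * (\<Sum>u\<in>M. of_bool (u \<in> p)))"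
    by (subst sum.swap) (simp add: sum_distrib_left)
  also have "\<dots> = (\<Sum>p\<in>pairs M. h p * 2)"
  proof (intro sum.cong refl)
    fix p assume "p \<in> pairs M"
    then have "p \<subseteq> M" "card p = 2" by (simp_all add: pairs_def)
    then have "M \<inter> {u. u \<in> p} = p" by auto
    then have "(\<Sum>u\<in>M. of_bool (u \<in> p)) = real (card p)"
      using assms(1) by (simp add: of_bool_def sum.If_cases)
    then show "h p * (\<Sum>u\<in>M. of_bool (u \<in> p)) = h p * 2" using \<open>card p = 2\<close> by simp
  qed
  finally show ?thesis by (simp add: sum_distrib_right[symmetric] mult.commute)
qed

lemma sum_over_cut:
  assumes "finite M" "B \<subseteq> M"
  shows "(\<Sum>u\<in>M. \<Sum>v\<in>M. c * x {u, v} * of_bool (u \<in> B \<and> v \<notin> B)) = c * cross x B (M - B)"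
proof -
  have inner: "(\<Sum>v\<in>M. c * x {u, v} * of_bool (u \<in> B \<and> v \<notin> B)) = (if u \<in> B then \<Sum>v\<in>M - B. c * x {u, v} else 0)" for u
    using assms(1) by (auto intro: sum.mono_neutral_cong_right)
  show ?thesis
    unfolding inner using assms
    by (simp add: sum.If_cases Int_absorb1 cross_def sum_distrib_left)
qed

lemma card_conv_sum: "real (card {j. j < (N::nat) \<and> P j}) = (\<Sum>j<N. of_bool (P j))"
  by (simp add: of_bool_def sum.If_cases Collect_conj_eq lessThan_def)

text \<open>
  The Euler walk of the digraph with \<open>K * y {u, v}\<close> arcs from \<open>u\<close> to \<open>v\<close>. Both directions carry the
  same number of arcs, so the vertices are balanced and each cut of weight \<open>1\<close> is crossed \<open>K\<close> times
  in either direction.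
\<close>

lemma multi_tour_of_weights:
  assumes T: "distinct_leaves T" "r \<notin> leaves T" "M = insert r (leaves T)"
    and A: "leaves ` subtrees T = A ` E"
    and part: "\<And>e. e \<in> E \<Longrightarrow> edge_partition V E M e = {A e, M - A e}"
    and y: "\<And>p. 0 \<le> y p" "\<And>p. p \<notin> pairs M \<Longrightarrow> y p = 0"
    and eq: "\<And>t. t \<in> subtrees T \<Longrightarrow> cross y (leaves t) (M - leaves t) = 1"
    and K: "0 < K" "\<And>p. real K * y p \<in> \<int>"
  shows "\<exists>\<pi>. multi_tour V E M K \<pi> \<and>
    (\<forall>\<rho>. multi_perimeter M \<rho> K \<pi> = (\<Sum>u\<in>M. \<Sum>v\<in>M. y {u, v} * \<rho> u v) / 2)"
proof -
  have M: "finite M" "M \<noteq> {}" "leaves T \<subseteq> M" using T(3) by auto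
  define a where "a u v = nat \<lfloor>real K * y {u, v}\<rfloor>" for u v
  have a: "real (a u v) = real K * y {u, v}" for u v
  proof -
    obtain i where i: "real K * y {u, v} = of_int i" using K(2) by (auto elim: Ints_cases)
    moreover have "0 \<le> real K * y {u, v}" using y(1) by simp
    ultimately show ?thesis by (simp add: a_def)
  qed
  have loop: "y {u} = 0" for u by (rule y(2)) (simp add: pairs_def)
  have vertex: "cross y {u} (M - {u}) = 1" if "u \<in> M" for u
  proof (cases "u = r")
    case True
    have "M - leaves T = {r}" "M - {r} = leaves T" using T by auto
    then show ?thesis using eq[of T] cross_commute[of y "{r}" "leaves T"] True by simp
  next
    case False
    then show ?thesis using eq[of "Leaf u"] that T(3) by (simp add: leaf_subtree_iff)
  qed
  have row: "(\<Sum>v\<in>M. y {u, v}) = 1" if "u \<in> M" for u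
    using vertex[OF that] that M(1) loop[of u] by (simp add: cross_def sum.remove[of M u])
  have deg: "(\<Sum>v\<in>M. a u v) = K" if "u \<in> M" for u
  proof -
    have "real (\<Sum>v\<in>M. a u v) = real K * (\<Sum>v\<in>M. y {u, v})" by (simp add: a sum_distrib_left)
    then have "real (\<Sum>v\<in>M. a u v) = real K" using row[OF that] by simp
    then show ?thesis by (simp only: of_nat_eq_iff)
  qed
  have sym: "a u v = a v u" for u v by (simp add: a_def insert_commute)
  have conn: "(u, v) \<in> {(u, v). u \<in> M \<and> v \<in> M \<and> a u v \<noteq> 0}\<^sup>*" if "u \<in> M" "v \<in> M" for u v
  proof -
    have "a u v \<noteq> 0" if "y {u, v} \<noteq> 0" for u v
    proof
      assume "a u v = 0"
      then show False using a[of u v] K(1) that by simp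
    qed
    then have "{(u, v). u \<in> M \<and> v \<in> M \<and> u \<noteq> v \<and> y {u, v} \<noteq> 0} \<subseteq> {(u, v). u \<in> M \<and> v \<in> M \<and> a u v \<noteq> 0}"
      by blast
    then show ?thesis
      using support_connected[OF M(1) T eq that] rtrancl_mono by blast
  qed
  define N where "N = card M * K"
  have N: "N = (\<Sum>u\<in>M. \<Sum>v\<in>M. a u v)" by (simp add: N_def deg)
  have bal: "(\<Sum>v\<in>M. a v u) = (\<Sum>v\<in>M. a u v)" for u by (simp add: sym[of u])
  obtain \<pi> where \<pi>: "\<pi> \<in> {..<N} \<rightarrow> M"
    and F': "\<And>f :: 'a \<Rightarrow> 'a \<Rightarrow> real.
      (\<Sum>j<N. f (\<pi> j) (\<pi> (Suc j mod N))) = (\<Sum>u\<in>M. \<Sum>v\<in>M. real (a u v) * f u v)"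
    using euler_cyclic_sequence[OF M(1,2) bal conn N] by blast
  have F: "(\<Sum>j<N. f (\<pi> j) (\<pi> (Suc j mod N))) = (\<Sum>u\<in>M. \<Sum>v\<in>M. real K * y {u, v} * f u v)"
    for f :: "'a \<Rightarrow> 'a \<Rightarrow> real" unfolding F'[of f] a ..
  have inM: "\<pi> j \<in> M" if "j < N" for j using \<pi> that by auto
  have "\<pi> j \<noteq> \<pi> (Suc j mod N)" if j: "j < N" for j
  proof -
    have "(\<Sum>j<N. of_bool (\<pi> j = \<pi> (Suc j mod N))) = (\<Sum>u\<in>M. \<Sum>v\<in>M. real K * y {u, v} * of_bool (u = v))"
      by (rule F)
    also have "\<dots> = 0" by (intro sum.neutral ballI) (auto simp: loop)
    finally have "\<forall>j\<in>{..<N}. (of_bool (\<pi> j = \<pi> (Suc j mod N)) :: real) = 0"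
      by (subst (asm) sum_nonneg_eq_0_iff) auto
    then show ?thesis using j by auto
  qed
  moreover have "card {j. j < N \<and> \<pi> j = w} = K" if w: "w \<in> M" for w
  proof -
    have "real (card {j. j < N \<and> \<pi> j = w}) = (\<Sum>u\<in>M. \<Sum>v\<in>M. real K * y {u, v} * of_bool (u = w))"
      unfolding card_conv_sum by (rule F)
    also have "\<dots> = (\<Sum>u\<in>M. if u = w then real K else 0)"
      by (intro sum.cong refl) (auto simp: row sum_distrib_left[symmetric])
    also have "\<dots> = real K" using M(1) w by simp
    finally show ?thesis by simp
  qed
  ultimately have order: "multi_cyclic_order M K \<pi>"
    using K(1) \<pi> by (simp add: multi_cyclic_order_def N_def)
  have "card {p. p < N \<and> \<pi> p \<in> B \<and> \<pi> (Suc p mod N) \<notin> B} = K"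
    if e: "e \<in> E" and B: "B \<in> edge_partition V E M e" for e B
  proof -
    obtain t where t: "t \<in> subtrees T" "leaves t = A e" using A e by (metis imageE imageI)
    have AM: "A e \<subseteq> M" using leaves_subtree[OF t(1)] t(2) M(3) by simp
    have cut: "cross y (A e) (M - A e) = 1" using eq[OF t(1)] t(2) by simp
    consider "B = A e" | "B = M - A e" using B part[OF e] by blast
    then have "B \<subseteq> M \<and> cross y B (M - B) = 1"
    proof cases
      case 2
      have "M - (M - A e) = A e" using AM by blast
      then show ?thesis using 2 cut cross_commute[of y "M - A e" "A e"] by auto
    qed (use cut AM in auto)
    moreover have "real (card {p. p < N \<and> \<pi> p \<in> B \<and> \<pi> (Suc p mod N) \<notin> B})
        = (\<Sum>u\<in>M. \<Sum>v\<in>M. real K * y {u, v} * of_bool (u \<in> B \<and> v \<notin> B))"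
      unfolding card_conv_sum by (rule F)
    ultimately show ?thesis using sum_over_cut[OF M(1), of B "real K" y] by simp
  qed
  then have tour: "multi_tour V E M K \<pi>"
    using order K(1) unfolding multi_tour_def N_def by blast
  show ?thesis
  proof (intro exI[of _ \<pi>] conjI allI)
    show "multi_tour V E M K \<pi>" by (rule tour)
    fix \<rho> :: "'a \<Rightarrow> 'a \<Rightarrow> real"
    have "multi_perimeter M \<rho> K \<pi> = 1 / (2 * real K) * (\<Sum>u\<in>M. \<Sum>v\<in>M. real K * y {u, v} * \<rho> u v)"
      unfolding multi_perimeter_def N_def[symmetric] by (simp only: F)
    also have "(\<Sum>u\<in>M. \<Sum>v\<in>M. real K * y {u, v} * \<rho> u v) = real K * (\<Sum>u\<in>M. \<Sum>v\<in>M. y {u, v} * \<rho> u v)"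
      by (simp add: sum_distrib_left mult.assoc)
    finally show "multi_perimeter M \<rho> K \<pi> = (\<Sum>u\<in>M. \<Sum>v\<in>M. y {u, v} * \<rho> u v) / 2"
      using K(1) by simp
  qed
qed

theorem mainTheorem2:
  fixes M V :: "'a set" and E :: "'a set set" and \<rho> :: "'a \<Rightarrow> 'a \<Rightarrow> real" and n :: nat
  assumes "Metric_space M \<rho>" and "finite M" and "card M = n" and "n \<ge> 3"
    and "binary_tree V E" and "connects V E M"
  shows "\<exists>k \<pi>. multi_tour V E M k \<pi> \<and> k \<le> 2 ^ (2 * n - 5) \<and>
           ereal (multi_perimeter M \<rho> k \<pi>) = mpf_minus M \<rho> V E"
proof -
  interpret Metric_space M \<rho> by fact
  have "M \<noteq> {}" using assms(3,4) by auto
  then obtain r where r: "r \<in> M" by blast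
  obtain T A where T: "distinct_leaves T" "leaves T = M - {r}" and A: "leaves ` subtrees T = A ` E"
    and part: "\<And>e. e \<in> E \<Longrightarrow> edge_partition V E M e = {A e, M - A e}"
    and path: "\<And>u v. u \<in> M \<Longrightarrow> v \<in> M \<Longrightarrow> tree_path_edges V E u v = {e \<in> E. (u \<in> A e) \<noteq> (v \<in> A e)}"
    by (rule binary_tree_leaf_tree[OF assms(5,6) r]) blast
  have T': "distinct_leaves T" "r \<notin> leaves T" "M = insert r (leaves T)" using T r by auto
  have M: "finite M" by fact
  have E: "finite E"
    using assms(5) by (intro finite_tree.finite_E[of V] finite_tree.intro) (simp add: binary_tree_def)
  have AT: "\<exists>t\<in>subtrees T. leaves t = A e" if "e \<in> E" for e
    using imageI[OF that, of A] unfolding A[symmetric] by auto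
  have TA: "\<exists>e\<in>E. A e = leaves t" if "t \<in> subtrees T" for t
    using imageI[OF that, of leaves] unfolding A by auto
  have AM: "A e \<subseteq> M" if "e \<in> E" for e
    using AT[OF that] leaves_subtree[of _ T] T(2) by blast
  define P where "P = pairs M"
  have P: "finite P" using finite_pairs[OF M] by (simp add: P_def)
  \<comment> \<open>the dual linear program: \<open>col p e = 1\<close> iff the edge \<open>e\<close> separates the points of the pair \<open>p\<close>\<close>
  define col where "col p e = (of_bool (joins (A e) (M - A e) p) :: real)" for p e
  \<comment> \<open>\<open>\<rho>\<close> as a function of unordered pairs: the double sum counts \<open>\<rho> u v\<close> twice and \<open>\<rho> u u = 0\<close>\<close>
  define R where "R p = (\<Sum>u\<in>p. \<Sum>v\<in>p. \<rho> u v) / 2" for p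
  have R: "R {u, v} = \<rho> u v" if "u \<in> M" "v \<in> M" "u \<noteq> v" for u v
    using that commute[of u v] mdist_zero[of u] mdist_zero[of v] by (simp add: R_def)
  have cut: "(\<Sum>p\<in>P. x p * col p e) = cross x (A e) (M - A e)" if "e \<in> E" for x e
    unfolding P_def col_def using M AM[OF that] by (intro sum_joining_pairs) auto
  have filling: "generalized_filling M \<rho> V E w \<longleftrightarrow> (\<forall>p\<in>P. R p \<le> (\<Sum>e\<in>E. col p e * w e))" for w
  proof -
    have path_sum: "(\<Sum>e\<in>tree_path_edges V E u v. w e) = (\<Sum>e\<in>E. col {u, v} e * w e)"
      if "u \<in> M" "v \<in> M" for u v
    proof -
      have "joins (A e) (M - A e) {u, v} \<longleftrightarrow> (u \<in> A e) \<noteq> (v \<in> A e)" for e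
        using that by (auto simp: joins_def)
      then show ?thesis
        unfolding path[OF that] using E by (intro sum.mono_neutral_cong_left) (auto simp: col_def)
    qed
    have "(\<forall>p\<in>P. R p \<le> (\<Sum>e\<in>E. col p e * w e)) \<longleftrightarrow>
        (\<forall>u\<in>M. \<forall>v\<in>M. u \<noteq> v \<longrightarrow> R {u, v} \<le> (\<Sum>e\<in>E. col {u, v} e * w e))"
      unfolding P_def by (auto simp: pair_in_pairs elim!: pairsE)
    then show ?thesis by (simp add: generalized_filling_def path_sum R)
  qed
  obtain x0 where x0: "\<And>p. 0 \<le> x0 p" "\<And>t. t \<in> subtrees T \<Longrightarrow> cross x0 (leaves t) (M - leaves t) = 1"
    using fractional_tour_exists[OF T'] by blast
  have feas0: "lp_feasible P E col (\<lambda>_. 1) (\<lambda>p. if p \<in> P then x0 p else 0)"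
  proof -
    have "(\<Sum>p\<in>P. (if p \<in> P then x0 p else 0) * col p e) = 1" if "e \<in> E" for e
    proof -
      have "(\<Sum>p\<in>P. (if p \<in> P then x0 p else 0) * col p e) = (\<Sum>p\<in>P. x0 p * col p e)"
        by (intro sum.cong refl) simp
      moreover obtain t where "t \<in> subtrees T" "leaves t = A e" using AT[OF \<open>e \<in> E\<close>] by blast
      ultimately show ?thesis using x0(2)[of t] cut[OF that, of x0] by simp
    qed
    then show ?thesis using x0(1) by (simp add: lp_feasible_def)
  qed
  have pos: "0 < (\<Sum>e\<in>E. 1 * col p e)" if p: "p \<in> P" for p
  proof -
    obtain u v where "p = {u, v}" "u \<in> M" "v \<in> M" "u \<noteq> v"
      using p unfolding P_def by (rule pairsE)
    moreover have "{u, v} = {v, u}" by blast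
    ultimately obtain u v where uv: "p = {u, v}" "u \<in> leaves T" "v \<in> M" "u \<noteq> v"
      unfolding T(2) by blast
    then obtain e where e: "e \<in> E" "A e = {u}" using TA[of "Leaf u"] by (auto simp: leaf_subtree_iff)
    have "col p e = 1" using uv e by (auto simp: col_def joins_def)
    then show ?thesis using E e(1) by (intro sum_pos2[of E e]) (auto simp: col_def)
  qed
  obtain y where feas: "lp_feasible P E col (\<lambda>_. 1) y"
    and ind: "independent_columns P E col {p. y p \<noteq> 0}"
    and opt: "\<And>t. (\<Sum>p\<in>P. y p * R p) < t \<Longrightarrow>
      \<exists>w. (\<forall>p\<in>P. R p \<le> (\<Sum>e\<in>E. col p e * w e)) \<and> (\<Sum>e\<in>E. 1 * w e) < t"
    using lp_basic_optimum[OF P E pos feas0, where b = R] by blast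
  have y: "\<And>p. 0 \<le> y p" "\<And>p. p \<notin> pairs M \<Longrightarrow> y p = 0" "\<And>e. e \<in> E \<Longrightarrow> (\<Sum>p\<in>P. y p * col p e) = 1"
    using feas by (auto simp: lp_feasible_def P_def)
  have y_cut: "cross y (leaves t) (M - leaves t) = 1" if "t \<in> subtrees T" for t
  proof -
    obtain e where "e \<in> E" "A e = leaves t" using TA[OF \<open>t \<in> subtrees T\<close>] by blast
    then show ?thesis using y(3)[of e] cut[of e y] by simp
  qed
  have "\<exists>K::nat. 0 < K \<and> K \<le> 2 ^ (2 * card M - 5) \<and> (\<forall>p. real K * y p \<in> \<int>)"
  proof (rule tree_denominator[OF T' _ y(2) y_cut])
    show "3 \<le> card M" using assms(3,4) by simp
    fix z assume z: "\<forall>p. y p = 0 \<longrightarrow> z p = 0" "\<forall>t\<in>subtrees T. cross z (leaves t) (M - leaves t) = 0"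
    have "(\<Sum>p\<in>P. z p * col p e) = 0" if "e \<in> E" for e
    proof -
      obtain t where "t \<in> subtrees T" "leaves t = A e" using AT[OF \<open>e \<in> E\<close>] by blast
      then show ?thesis using bspec[OF z(2), of t] cut[OF \<open>e \<in> E\<close>, of z] by simp
    qed
    then show "\<forall>p. z p = 0"
      using ind[unfolded independent_columns_def, THEN spec, of z] z(1) by simp
  qed
  then obtain K :: nat where K: "0 < K" "K \<le> 2 ^ (2 * card M - 5)" and K_int: "\<forall>p. real K * y p \<in> \<int>"
    by (elim exE conjE)
  obtain \<pi> where tour: "multi_tour V E M K \<pi>"
    and perimeter: "\<forall>\<rho>. multi_perimeter M \<rho> K \<pi> = (\<Sum>u\<in>M. \<Sum>v\<in>M. y {u, v} * \<rho> u v) / 2"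
    using multi_tour_of_weights[OF T' A part y(1,2) y_cut K(1) K_int[THEN spec]] by blast
  define val where "val = (\<Sum>p\<in>P. y p * R p)"
  have "multi_perimeter M \<rho> K \<pi> = val"
  proof -
    have "(\<Sum>u\<in>M. \<Sum>v\<in>M. y {u, v} * \<rho> u v) = (\<Sum>u\<in>M. \<Sum>v\<in>M. y {u, v} * R {u, v})"
    proof (intro sum.cong refl)
      fix u v assume "u \<in> M" "v \<in> M"
      then show "y {u, v} * \<rho> u v = y {u, v} * R {u, v}"
        using R[of u v] y(2)[of "{u, u}"] by (cases "u = v") (auto simp: pairs_def)
    qed
    also have "\<dots> = 2 * val"
      unfolding val_def P_def using M y(2) by (intro sum_ordered_pairs) simp_all
    finally show ?thesis using perimeter[THEN spec, of \<rho>] by simp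
  qed
  moreover have "mpf_minus M \<rho> V E = ereal val"
  proof (rule antisym)
    show "mpf_minus M \<rho> V E \<le> ereal val"
    proof (rule dense_ge)
      fix s assume s: "ereal val < s"
      show "mpf_minus M \<rho> V E \<le> s"
      proof (cases s)
        case (real t)
        then obtain w where w: "\<forall>p\<in>P. R p \<le> (\<Sum>e\<in>E. col p e * w e)" "(\<Sum>e\<in>E. w e) < t"
          using opt[of t] s by (auto simp: val_def)
        have "mpf_minus M \<rho> V E \<le> ereal (\<Sum>e\<in>E. w e)"
          unfolding mpf_minus_def using w(1) filling by (intro INF_lower) simp
        also have "\<dots> \<le> s" using w(2) real by simp
        finally show ?thesis .
      qed (use s in auto)
    qed
    show "ereal val \<le> mpf_minus M \<rho> V E"
      unfolding mpf_minus_def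
    proof (rule INF_greatest)
      fix w assume "w \<in> {w. generalized_filling M \<rho> V E w}"
      then have w: "R p \<le> (\<Sum>e\<in>E. col p e * w e)" if "p \<in> P" for p using filling that by blast
      have "val \<le> (\<Sum>p\<in>P. y p * (\<Sum>e\<in>E. col p e * w e))"
        unfolding val_def by (intro sum_mono mult_left_mono w y(1))
      also have "\<dots> = (\<Sum>e\<in>E. (\<Sum>p\<in>P. y p * col p e) * w e)"
        by (simp add: sum_distrib_left sum_distrib_right mult.assoc) (rule sum.swap)
      also have "\<dots> = (\<Sum>e\<in>E. w e)" using y(3) by (intro sum.cong refl) simp
      finally show "ereal val \<le> ereal (\<Sum>e\<in>E. w e)" by simp
    qed
  qed
  ultimately have "ereal (multi_perimeter M \<rho> K \<pi>) = mpf_minus M \<rho> V E" by simp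
  then show ?thesis using tour K(2) assms(3) by blast
qed

end
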